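(* Let $k \geq 3$ be an integer. There exists a bijection $\varphi : SP_{k-1} \rightarrow IS_k$ such that $\overrightarrow{fr}(\varphi(f)) = \overrightarrow{fix}(f)$ for all $f \in SP_{k-1}$.
   Context: For a positive integer $n$, $[n]=\{1,\dots,n\}$. A surjective pistol of height $n$ is a surjective map $f:[2n]\to\{2,4,\dots,2n\}$ with $f(j)\ge j$ for all $j\in[2n]$; $SP_n$ denotes the set of them. For $f\in SP_{k-1}$, $\overrightarrow{fix}(f)=(t_1,\dots,t_{k-2})\in\{0,1\}^{k-2}$ where $t_i=1$ iff $f(2i)=2i$. A partition $\lambda=(\lambda_1\ge\dots\ge\lambda_m)$ (possibly empty) is drawn as its Ferrers diagram in French convention: left-justified rows, the $i$-th row from bottom to top having $\lambda_i$ cells. The hook length of a cell $c$ is the number of cells in its row weakly to its right (including $c$) plus the number of cells strictly above it in its column. For a positive integer $k$, the $k$-boundary $\partial^k(\lambda)$ is the set of cells of $\lambda$ of hook length at most $k$ (a skew diagram); its $k$-rim is the lower border of $\partial^k(\lambda)$. $rs^k(\lambda)$ (resp. $cs^k(\lambda)$) is the sequence of lengths of the rows of $\partial^k(\lambda)$ from bottom to top (resp. heights of its columns from left to right). $\lambda$ is a $k$-shape if $rs^k(\lambda)$ and $cs^k(\lambda)$ are both partitions (weakly decreasing). For a $k$-shape $\lambda$ and positive integers $u,v$, $H_u(\lambda)$ (resp. $V_v(\lambda)$) is the set of cells of $\partial^k(\lambda)$ lying in a row of $\partial^k(\lambda)$ of length $u$ (resp. in a column of $\partial^k(\lambda)$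 of height $v$); $V_0(\lambda)=\emptyset$. The horizontal steps of the $k$-rim are the bottom edges of the lowest cells of the columns of $\partial^k(\lambda)$; a set $S$ of cells contains such a step if the corresponding lowest cell lies in $S$ (so the number of horizontal steps of the $k$-rim in $H_u(\lambda)\cap V_v(\lambda)$ is the number of columns of $\partial^k(\lambda)$ of height $v$ whose lowest cell lies in a row of $\partial^k(\lambda)$ of length $u$). An irreducible $k$-shape is a $k$-shape $\lambda$ such that for every $i\in[k]$, each of the sets $H_i(\lambda)\cap V_{k-i}(\lambda)$ and $H_i(\lambda)\cap V_{k+1-i}(\lambda)$ contains at most $i-1$ horizontal steps of the $k$-rim of $\lambda$. $IS_k$ denotes the set of irreducible $k$-shapes. For $k\ge3$ and $\lambda\in IS_k$, an integer $i\in[k-2]$ is a free $k$-site of $\lambda$ if $H_{k-i}(\lambda)\cap V_{i+1}(\lambda)=\emptyset$, and $\overrightarrow{fr}(\lambda)=(t_1,\dots,t_{k-2})$ with $t_i=1$ iff $i$ is a free $k$-site. *)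

theory Defs
  imports Main "HOL-Library.FuncSet"
begin

text \<open>Surjective pistols of height \<open>n\<close>; extensionality makes them literally maps on \<open>[2n]\<close>.\<close>

definition surj_pistols :: "nat \<Rightarrow> (nat \<Rightarrow> nat) set" where
  "surj_pistols n =
     {f \<in> {1..2*n} \<rightarrow>\<^sub>E (\<lambda>i. 2*i) ` {1..n}.
        f ` {1..2*n} = (\<lambda>i. 2*i) ` {1..n} \<and> (\<forall>j\<in>{1..2*n}. j \<le> f j)}"

text \<open>The vector \<open>(t\<^sub>1, \<dots>, t\<^bsub>k-2\<^esub>)\<close> of a pistol of height \<open>k - 1\<close>.\<close>

definition fix_vec :: "nat \<Rightarrow> (nat \<Rightarrow> nat) \<Rightarrow> nat list" where
  "fix_vec k f = map (\<lambda>i. if f (2*i) = 2*i then 1 else 0) [1..<k-1]"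

definition is_partition :: "nat list \<Rightarrow> bool" where
  "is_partition l \<longleftrightarrow> sorted_wrt (\<ge>) l \<and> 0 \<notin> set l"

text \<open>A cell is a pair (row, column), both counted from \<open>0\<close>, rows from bottom to top (French
  convention).\<close>

type_synonym cell = "nat \<times> nat"

definition diagram :: "nat list \<Rightarrow> cell set" where
  "diagram l = {(i, j). i < length l \<and> j < l ! i}"

definition hook_length :: "nat list \<Rightarrow> cell \<Rightarrow> nat" where
  "hook_length l = (\<lambda>(i, j). card {j'. j \<le> j' \<and> (i, j') \<in> diagram l}
                           + card {i'. i < i' \<and> (i', j) \<in> diagram l})"

definition k_boundary :: "nat \<Rightarrow> nat list \<Rightarrow> cell set" where
  "k_boundary k l = {c \<in> diagram l. hook_length l c \<le> k}"

definition row_len :: "nat \<Rightarrow> nat list \<Rightarrow> nat \<Rightarrow> nat" where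
  "row_len k l i = card {j. (i, j) \<in> k_boundary k l}"

definition col_ht :: "nat \<Rightarrow> nat list \<Rightarrow> nat \<Rightarrow> nat" where
  "col_ht k l j = card {i. (i, j) \<in> k_boundary k l}"

text \<open>As for any skew diagram, the sequences run over all rows and columns of \<open>l\<close>, so a row or
  column of \<open>l\<close> without cells in the \<open>k\<close>-boundary contributes a \<open>0\<close>.\<close>

definition row_seq :: "nat \<Rightarrow> nat list \<Rightarrow> nat list" where
  "row_seq k l = map (row_len k l) [0..<length l]"

definition col_seq :: "nat \<Rightarrow> nat list \<Rightarrow> nat list" where
  "col_seq k l = map (col_ht k l) [0..<(if l = [] then 0 else hd l)]"

definition k_shape :: "nat \<Rightarrow> nat list \<Rightarrow> bool" where
  "k_shape k l \<longleftrightarrow>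
     is_partition l \<and> sorted_wrt (\<ge>) (row_seq k l) \<and> sorted_wrt (\<ge>) (col_seq k l)"

text \<open>\<open>V_cells k l 0\<close> is empty, since a column containing a cell of the \<open>k\<close>-boundary has positive
  height.\<close>

definition H_cells :: "nat \<Rightarrow> nat list \<Rightarrow> nat \<Rightarrow> cell set" where
  "H_cells k l u = {(i, j) \<in> k_boundary k l. row_len k l i = u}"

definition V_cells :: "nat \<Rightarrow> nat list \<Rightarrow> nat \<Rightarrow> cell set" where
  "V_cells k l v = {(i, j) \<in> k_boundary k l. col_ht k l j = v}"

text \<open>A horizontal step of the \<open>k\<close>-rim is the bottom edge of the lowest cell of a column of the
  \<open>k\<close>-boundary and is represented by that cell.\<close>

definition h_steps :: "nat \<Rightarrow> nat list \<Rightarrow> cell set" where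
  "h_steps k l = {(i, j) \<in> k_boundary k l. \<forall>i'<i. (i', j) \<notin> k_boundary k l}"

definition irreducible_k_shapes :: "nat \<Rightarrow> nat list set" where
  "irreducible_k_shapes k =
     {l. k_shape k l \<and>
         (\<forall>i\<in>{1..k}.
            card (h_steps k l \<inter> (H_cells k l i \<inter> V_cells k l (k - i))) \<le> i - 1 \<and>
            card (h_steps k l \<inter> (H_cells k l i \<inter> V_cells k l (k + 1 - i))) \<le> i - 1)}"

definition free_site :: "nat \<Rightarrow> nat list \<Rightarrow> nat \<Rightarrow> bool" where
  "free_site k l i \<longleftrightarrow> H_cells k l (k - i) \<inter> V_cells k l (i + 1) = {}"

definition fr_vec :: "nat \<Rightarrow> nat list \<Rightarrow> nat list" where
  "fr_vec k l = map (\<lambda>i. if free_site k l i then 1 else 0) [1..<k-1]"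

end

theory Submission
  imports Defs
begin

text \<open>
  Build a \<open>k\<close>-shape by adding rows at the bottom. The columns that still meet the \<open>k\<close>-boundary
  form a queue; grouped by height they occupy the cells of a cyclic word, and adding a row
  rotates the word by one cell: the highest columns are finished and replaced by new ones.
  When rows of length \<open>u\<close> begin, one column is added to the first cell; the word then has
  \<open>k + 1 - u\<close> cells, and at some moment, when the first cell is occupied, the first two cells are
  merged. Irreducibility says precisely that the word never makes a full turn between two such
  events, so an irreducible \<open>k\<close>-shape is a sequence of pairs of rotation amounts, and the site \<open>k - u\<close> is
  free iff the merge for \<open>u\<close> happens at once.

  Run backwards, the number of ways to perform one merge-and-add step depends only on the number
  \<open>m\<close> of occupied cells, which gives a linear recursion for a function of \<open>m\<close>. Surjective pistols
  with prescribed fixed points satisfy a recursion on functions of the number \<open>q\<close> of available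
  values. The two operators are adjoint for the pairing
  \<open>\<Sum>m\<ge>1. f m * (\<Delta>^(m-1) w) 1\<close>, where \<open>\<Delta>\<close> is the forward difference, so the two families have the
  same number of members for each prescribed vector.
\<close>

section \<open>The boundary, row by row\<close>

text \<open>The hook condition nearly determines a row of length \<open>u\<close>: before the row is
  added, its first column has height at most \<open>k - u\<close>, and the column to the left of it
  has height at least \<open>k - u\<close>. Only columns of height exactly \<open>k - u\<close> may
  be either met or left behind; this is the origin of the two regimes. Since column heights of the
  boundary decrease from left to right, a column left at height \<open>k - u\<close> forbids a later
  one of height \<open>k + 1 - u\<close>. Hence there is a single change of regime, and a single
  merge, for each \<open>u\<close>.

  The two families use the vector in opposite orders: for codes the flag of site 1 belongs to the
  longest rows, whose operator is applied last, while for pistols the first flag acts first, on the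
  constant function 1. Passing to the adjoint reverses this order. The pairing is the one of Newton
  expansions at 1, in which multiplication by \<open>q\<close> and the forward difference have few
  nonzero coefficients, just as the code recursion links \<open>m\<close> only to its neighbours.
  The bijection then comes from equal cardinalities of finite fibres, not from an explicit
  map.\<close>

definition full_ht :: "nat list \<Rightarrow> nat \<Rightarrow> nat" where
  "full_ht l j = length (filter (\<lambda>x. j < x) l)"

definition first_row :: "nat \<Rightarrow> nat \<Rightarrow> nat list \<Rightarrow> nat set" where
  "first_row k x l = {j. j < x \<and> x - j + full_ht l j \<le> k}"

text \<open>A column that meets the boundary carries exactly one horizontal step, so steps can be
  indexed by columns. The head of the list is the bottom row, so the first hit of the recursion is
  the lowest cell; the value 0 marks a column without boundary cells.\<close>

fun base_len :: "nat \<Rightarrow> nat list \<Rightarrow> nat \<Rightarrow> nat" where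
  "base_len k [] j = 0"
| "base_len k (x # l) j =
     (if j \<in> first_row k x l then card (first_row k x l) else base_len k l j)"

definition step_count :: "nat \<Rightarrow> nat list \<Rightarrow> nat \<Rightarrow> nat \<Rightarrow> nat" where
  "step_count k l u v = card {j. base_len k l j = u \<and> col_ht k l j = v}"

lemma full_ht_Nil [simp]: "full_ht [] j = 0"
  and full_ht_Cons [simp]: "full_ht (x # l) j = (if j < x then 1 else 0) + full_ht l j"
  by (auto simp: full_ht_def)

lemma full_ht_antimono: "j \<le> j' \<Longrightarrow> full_ht l j' \<le> full_ht l j"
  by (induction l) auto

lemma diagram_Nil [simp]: "diagram [] = {}"
  by (auto simp: diagram_def)

lemma diagram_Cons_0 [simp]: "(0, j) \<in> diagram (x # l) \<longleftrightarrow> j < x"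
  and diagram_Cons_Suc [simp]: "(Suc i, j) \<in> diagram (x # l) \<longleftrightarrow> (i, j) \<in> diagram l"
  by (auto simp: diagram_def)

lemma card_column: "card {i. (i, j) \<in> diagram l} = full_ht l j"
  by (simp add: diagram_def full_ht_def length_filter_conv_card)

lemma hook_length_Cons_0: "hook_length (x # l) (0, j) = x - j + full_ht l j"
proof -
  have "{i'. 0 < i' \<and> (i', j) \<in> diagram (x # l)} = Suc ` {i. (i, j) \<in> diagram l}"
    by (auto simp: image_iff gr0_conv_Suc)
  moreover have "{j'. j \<le> j' \<and> (0, j') \<in> diagram (x # l)} = {j..<x}"
    by auto
  ultimately show ?thesis
    by (simp add: hook_length_def card_image card_column)
qed

text \<open>Hooks extend to the right and upwards, so a new bottom row changes no old hook length.
  This is what allows the boundary to be built row by row from the top.\<close>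

lemma hook_length_Cons_Suc: "hook_length (x # l) (Suc i, j) = hook_length l (i, j)"
proof -
  have "{i'. Suc i < i' \<and> (i', j) \<in> diagram (x # l)} = Suc ` {i'. i < i' \<and> (i', j) \<in> diagram l}"
  proof (intro set_eqI)
    fix i'
    show "i' \<in> {i'. Suc i < i' \<and> (i', j) \<in> diagram (x # l)} \<longleftrightarrow>
          i' \<in> Suc ` {i'. i < i' \<and> (i', j) \<in> diagram l}"
      by (cases i') auto
  qed
  then show ?thesis
    by (simp add: hook_length_def card_image)
qed

lemma k_boundary_Nil [simp]: "k_boundary k [] = {}"
  and k_boundary_Cons_0 [simp]: "(0, j) \<in> k_boundary k (x # l) \<longleftrightarrow> j \<in> first_row k x l"
  and k_boundary_Cons_Suc [simp]:
    "(Suc i, j) \<in> k_boundary k (x # l) \<longleftrightarrow> (i, j) \<in> k_boundary k l"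
  by (auto simp: k_boundary_def first_row_def hook_length_Cons_0 hook_length_Cons_Suc)

lemma row_len_Cons_0 [simp]: "row_len k (x # l) 0 = card (first_row k x l)"
  and row_len_Cons_Suc [simp]: "row_len k (x # l) (Suc i) = row_len k l i"
  by (simp_all add: row_len_def)

lemma row_seq_Nil [simp]: "row_seq k [] = []"
  and row_seq_Cons [simp]: "row_seq k (x # l) = card (first_row k x l) # row_seq k l"
  by (simp_all add: row_seq_def upt_conv_Cons flip: map_Suc_upt del: upt_Suc)

lemma finite_first_row [simp]: "finite (first_row k x l)"
  by (rule finite_subset[of _ "{..<x}"]) (auto simp: first_row_def)

lemma col_ht_Nil [simp]: "col_ht k [] j = 0"
  by (simp add: col_ht_def)

lemma finite_k_boundary_column: "finite {i. (i, j) \<in> k_boundary k l}"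
  by (rule finite_subset[of _ "{..<length l}"]) (auto simp: k_boundary_def diagram_def)

lemma col_ht_Cons [simp]:
  "col_ht k (x # l) j = (if j \<in> first_row k x l then 1 else 0) + col_ht k l j"
proof -
  have "{i. (i, j) \<in> k_boundary k (x # l)} =
        (if j \<in> first_row k x l then {0} else {}) \<union> Suc ` {i. (i, j) \<in> k_boundary k l}"
  proof (intro set_eqI)
    fix i
    show "i \<in> {i. (i, j) \<in> k_boundary k (x # l)} \<longleftrightarrow>
      i \<in> (if j \<in> first_row k x l then {0} else {}) \<union> Suc ` {i. (i, j) \<in> k_boundary k l}"
      by (cases i) auto
  qed
  then show ?thesis
    by (auto simp: col_ht_def card_image finite_k_boundary_column card_insert_if)
qed

lemma col_ht_le_full_ht: "col_ht k l j \<le> full_ht l j"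
  by (induction l) (auto simp: first_row_def)

lemma first_row_upward: "j \<in> first_row k x l \<Longrightarrow> j \<le> j' \<Longrightarrow> j' < x \<Longrightarrow> j' \<in> first_row k x l"
  using full_ht_antimono[of j j' l] by (auto simp: first_row_def)

text \<open>Hook lengths decrease to the right along the bottom row, so its boundary cells form a
  final segment, determined by \<open>x\<close> and their number.\<close>

lemma first_row_interval: "first_row k x l = {x - card (first_row k x l)..<x}"
proof (cases "first_row k x l = {}")
  case False
  define b where "b = Min (first_row k x l)"
  have b: "b \<in> first_row k x l"
    using False by (auto simp: b_def)
  have "first_row k x l = {b..<x}"
  proof
    show "first_row k x l \<subseteq> {b..<x}"
      by (auto simp: b_def first_row_def[of k x l])
    show "{b..<x} \<subseteq> first_row k x l"
      using first_row_upward[OF b] by auto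
  qed
  moreover have "b < x"
    using b by (simp add: first_row_def)
  ultimately show ?thesis
    by simp
qed auto

lemma card_first_row_le: "card (first_row k x l) \<le> x"
  using card_mono[of "{..<x}" "first_row k x l"] by (auto simp: first_row_def)

lemma mem_first_row_iff:
  "j \<in> first_row k x l \<longleftrightarrow> j < x \<and> x \<le> j + card (first_row k x l)"
  by (subst first_row_interval) auto

text \<open>The leftmost boundary cell of the base row has hook length at most \<open>k\<close>, and
  the column above it is at least as high as the part of column \<open>j\<close> above the base row.
  The 1 is the base cell, which is counted both in the row and in the column.\<close>

lemma base_len_plus_col_ht_le: "base_len k l j + col_ht k l j \<le> k + 1"
proof (induction l)
  case (Cons x l)
  show ?case
  proof (cases "j \<in> first_row k x l")
    case True
    define b where "b = x - card (first_row k x l)"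
    have "card (first_row k x l) > 0"
      using True by (auto simp: card_gt_0_iff)
    then have "b \<in> first_row k x l" "b \<le> j"
      using True card_first_row_le[of k x l] mem_first_row_iff[of b k x l] mem_first_row_iff[of j k x l]
      by (auto simp: b_def)
    moreover have "x - b = card (first_row k x l)"
      using card_first_row_le[of k x l] by (simp add: b_def)
    ultimately have "card (first_row k x l) + full_ht l b \<le> k"
      by (auto simp: first_row_def)
    moreover have "col_ht k l j \<le> full_ht l b"
      using col_ht_le_full_ht[of k l j] full_ht_antimono[OF \<open>b \<le> j\<close>, of l] by linarith
    ultimately show ?thesis
      using True by simp
  qed (use Cons in simp)
qed simp

text \<open>A cell in a row longer than \<open>u\<close> would push a column with
  \<open>k \<le> u + v\<close> beyond the bound of \<open>base_len_plus_col_ht_le\<close>. Hence the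
  counts for a finished row length are frozen, in particular those at heights \<open>k - u\<close>
  and \<open>k + 1 - u\<close> on which irreducibility depends.\<close>

lemma step_count_Cons_gt:
  assumes "u < card (first_row k x l)" "k \<le> u + v"
  shows "step_count k (x # l) u v = step_count k l u v"
proof -
  have "\<not> (base_len k l j = u \<and> col_ht k l j = v)" if "j \<in> first_row k x l" for j
    using base_len_plus_col_ht_le[of k "x # l" j] that assms by auto
  then have "base_len k (x # l) j = u \<and> col_ht k (x # l) j = v \<longleftrightarrow>
             base_len k l j = u \<and> col_ht k l j = v" for j
    using assms by auto
  then show ?thesis
    by (simp only: step_count_def)
qed

lemma base_len_mem_row_seq: "base_len k l j \<noteq> 0 \<Longrightarrow> base_len k l j \<in> set (row_seq k l)"
  by (induction l) auto

lemma step_count_eq_0: "u \<noteq> 0 \<Longrightarrow> u \<notin> set (row_seq k l) \<Longrightarrow> step_count k l u v = 0"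
  using base_len_mem_row_seq[of k l] unfolding step_count_def by (metis (mono_tags, lifting) card.empty empty_Collect_eq)

lemma h_steps_Nil [simp]: "h_steps k [] = {}"
  and h_steps_Cons_0 [simp]: "(0, j) \<in> h_steps k (x # l) \<longleftrightarrow> j \<in> first_row k x l"
  and h_steps_Cons_Suc [simp]:
    "(Suc i, j) \<in> h_steps k (x # l) \<longleftrightarrow> j \<notin> first_row k x l \<and> (i, j) \<in> h_steps k l"
  by (auto simp: h_steps_def less_Suc_eq_0_disj)

lemma base_len_eq_iff:
  "u \<noteq> 0 \<Longrightarrow> base_len k l j = u \<longleftrightarrow> (\<exists>i. (i, j) \<in> h_steps k l \<and> row_len k l i = u)"
proof (induction l)
  case (Cons x l)
  have ex: "(\<exists>i. P i) \<longleftrightarrow> P 0 \<or> (\<exists>i. P (Suc i))" for P :: "nat \<Rightarrow> bool"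
    by (metis not0_implies_Suc)
  show ?case
    using Cons by (subst ex) auto
qed simp

lemma card_h_steps:
  assumes "u \<noteq> 0"
  shows "card (h_steps k l \<inter> (H_cells k l u \<inter> V_cells k l v)) = step_count k l u v"
proof -
  have "inj_on snd (h_steps k l)"
    by (auto simp: inj_on_def h_steps_def) (metis linorder_neqE_nat)+
  then have "inj_on snd (h_steps k l \<inter> (H_cells k l u \<inter> V_cells k l v))"
    by (rule inj_on_subset) simp
  moreover have "snd ` (h_steps k l \<inter> (H_cells k l u \<inter> V_cells k l v)) =
        {j. base_len k l j = u \<and> col_ht k l j = v}"
    unfolding base_len_eq_iff[OF assms]
    by (force simp: H_cells_def V_cells_def h_steps_def)
  ultimately show ?thesis
    unfolding step_count_def by (metis card_image)
qed

section \<open>Profiles of active columns\<close>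

lemma full_ht_beyond: "sorted_wrt (\<ge>) (x # l) \<Longrightarrow> x \<le> j \<Longrightarrow> full_ht (x # l) j = 0"
  by (induction l) auto

lemma k_shape_iff:
  "k_shape k l \<longleftrightarrow>
     is_partition l \<and> sorted_wrt (\<ge>) (row_seq k l) \<and> antimono (col_ht k l)"
proof -
  have "sorted_wrt (\<ge>) (col_seq k l) \<longleftrightarrow> antimono (col_ht k l)" if "is_partition l"
  proof (cases l)
    case (Cons x l')
    have zero: "col_ht k l j = 0" if "x \<le> j" for j
      using \<open>is_partition l\<close> full_ht_beyond[of x l' j] col_ht_le_full_ht[of k l j] that
      unfolding Cons by (simp add: is_partition_def)
    have "sorted_wrt (\<ge>) (col_seq k l) \<longleftrightarrow> (\<forall>i j. i < j \<longrightarrow> j < x \<longrightarrow> col_ht k l j \<le> col_ht k l i)"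
      by (simp add: col_seq_def Cons sorted_wrt_map sorted_wrt_iff_nth_less)
    also have "\<dots> \<longleftrightarrow> antimono (col_ht k l)"
      using zero unfolding antimono_def by (metis le_zero_eq linorder_not_le nat_less_le not_less_iff_gr_or_eq)
    finally show ?thesis .
  qed (simp add: col_seq_def antimono_def)
  then show ?thesis
    by (auto simp: k_shape_def)
qed

text \<open>Removing the bottom row lowers by one the heights on a final segment of the columns
  below \<open>x\<close>, and the columns from \<open>x\<close> on become or remain empty, so the
  heights stay decreasing.\<close>

lemma k_shape_Cons:
  assumes "k_shape k (x # l)"
  shows "k_shape k l"
proof -
  have anti: "antimono (col_ht k (x # l))" and part: "is_partition (x # l)"
    using assms by (simp_all add: k_shape_iff)
  have zero: "col_ht k l j = 0" if "x \<le> j" for j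
    using part full_ht_beyond[of x l j] col_ht_le_full_ht[of k l j] that
    by (simp add: is_partition_def split: if_splits)
  have "col_ht k l j' \<le> col_ht k l j" if "j \<le> j'" for j j'
    using antimonoD[OF anti that] first_row_upward[of j k x l j'] that zero[of j']
    by (cases "x \<le> j'") (auto split: if_splits)
  then show ?thesis
    using assms by (auto simp: k_shape_iff is_partition_def antimono_def)
qed

definition width :: "nat list \<Rightarrow> nat" where
  "width l = (case l of [] \<Rightarrow> 0 | x # _ \<Rightarrow> x)"

definition push :: "nat \<Rightarrow> nat list \<Rightarrow> nat list" where
  "push a l = (width l + a) # l"

text \<open>The entries \<open>d ! 1, d ! 2, \<dots>\<close> count the columns of full height \<open>length d - 1,
  length d - 2, \<dots>\<close>; all higher columns are finished, that is, cannot be met by the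
  \<open>k\<close>-boundary of a row added below. The entry \<open>d ! 0\<close> is the number of columns that the
  next row will create.\<close>

definition profile :: "nat \<Rightarrow> nat list \<Rightarrow> nat list \<Rightarrow> bool" where
  "profile k l d \<longleftrightarrow> k_shape k l \<and> d \<noteq> [] \<and>
     (\<forall>h\<in>{1..<length d}. card {j. full_ht l j = h} = d ! (length d - h)) \<and>
     (\<forall>j. full_ht l j < length d \<longrightarrow> col_ht k l j = full_ht l j) \<and>
     (\<forall>j. length d \<le> full_ht l j \<longrightarrow> length d \<le> col_ht k l j)"

lemma full_ht_pos: "is_partition l \<Longrightarrow> 0 < full_ht l j \<longleftrightarrow> j < width l"
  using full_ht_beyond[of "hd l" "tl l" j] by (cases l) (auto simp: is_partition_def width_def)

text \<open>The row length \<open>u\<close> is the number of active columns, including those to be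
  created. The threshold \<open>length d\<close> is \<open>k + 1 - u\<close> if columns of height
  \<open>k - u\<close> are still met (lax regime) and \<open>k - u\<close> if they are left behind
  (strict regime).\<close>

definition ready :: "nat \<Rightarrow> nat \<Rightarrow> nat list \<Rightarrow> nat list \<Rightarrow> bool" where
  "ready k u l d \<longleftrightarrow> profile k l d \<and> sum_list d = u \<and> 0 < u \<and>
     (length d + u = k \<or> length d + u = k + 1) \<and> (\<forall>r\<in>set (row_seq k l). r \<le> u)"

context
  fixes k u :: nat and l d :: "nat list"
  assumes ready: "ready k u l d"
begin

private lemma ready_facts:
  shows prof: "profile k l d"
    and sum: "sum_list d = u" "0 < u"
    and thresh: "length d + u = k \<or> length d + u = k + 1"
    and rows: "\<forall>r\<in>set (row_seq k l). r \<le> u"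
  using ready by (simp_all add: ready_def)

private lemma facts:
  shows part: "is_partition l" and anti: "antimono (col_ht k l)" and ne: "d \<noteq> []"
    and cnt: "\<And>h. 1 \<le> h \<Longrightarrow> h < length d \<Longrightarrow> card {j. full_ht l j = h} = d ! (length d - h)"
    and low: "\<And>j. full_ht l j < length d \<Longrightarrow> col_ht k l j = full_ht l j"
    and high: "\<And>j. length d \<le> full_ht l j \<Longrightarrow> length d \<le> col_ht k l j"
  using prof by (auto simp: profile_def k_shape_iff)

private lemma pos: "0 < full_ht l j \<longleftrightarrow> j < width l"
  by (rule full_ht_pos[OF part])

private lemma fin: "1 \<le> h \<Longrightarrow> finite {j. full_ht l j = h}"
  by (rule finite_subset[of _ "{..<width l}"]) (auto simp flip: pos)

private lemma card_active: "card {j. j < width l + hd d \<and> full_ht l j < length d} = u"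
proof -
  have split: "{j. j < width l + hd d \<and> full_ht l j < length d} =
      {width l..<width l + hd d} \<union> (\<Union>h\<in>{1..<length d}. {j. full_ht l j = h})"
  proof (intro set_eqI)
    fix j
    show "j \<in> {j. j < width l + hd d \<and> full_ht l j < length d} \<longleftrightarrow>
      j \<in> {width l..<width l + hd d} \<union> (\<Union>h\<in>{1..<length d}. {j. full_ht l j = h})"
      using pos[of j] ne by (cases "j < width l") (auto simp: Suc_le_eq)
  qed
  have "card (\<Union>h\<in>{1..<length d}. {j. full_ht l j = h}) = (\<Sum>h\<in>{1..<length d}. d ! (length d - h))"
    using fin cnt by (subst card_UN_disjoint) (auto intro!: sum.cong)
  also have "\<dots> = (\<Sum>i\<in>{1..<length d}. d ! i)"
    by (rule sum.reindex_bij_witness[of _ "\<lambda>i. length d - i" "\<lambda>i. length d - i"]) auto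
  finally have "card {j. j < width l + hd d \<and> full_ht l j < length d} =
      hd d + (\<Sum>i\<in>{1..<length d}. d ! i)"
    using fin pos unfolding split by (subst card_Un_disjoint) (fastforce simp: Suc_le_eq)+
  also have "\<dots> = (\<Sum>i\<in>{0..<length d}. d ! i)"
    using ne by (simp add: sum.atLeast_Suc_lessThan hd_conv_nth)
  finally show ?thesis
    using sum by (simp add: sum_list_sum_nth)
qed

text \<open>The active columns are the last \<open>u\<close> ones. An active column contributes at
  most \<open>u\<close> from the row and at most \<open>k - u\<close> from above, a finished one at
  least \<open>u + 1\<close> and at least \<open>k - u\<close>; so the hook lengths lie on the two
  sides of \<open>k\<close> in both regimes.\<close>

lemma first_row_push: "first_row k (width l + hd d) l = {j. j < width l + hd d \<and> full_ht l j < length d}"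
proof -
  define A where "A = {j. j < width l + hd d \<and> full_ht l j < length d}"
  have fA: "finite A" and cA: "card A = u"
    using card_active by (simp_all add: A_def)
  have iff: "j \<in> A \<longleftrightarrow> width l + hd d - j \<le> u" if "j < width l + hd d" for j
  proof
    assume "j \<in> A"
    then have "{j..<width l + hd d} \<subseteq> A"
      using full_ht_antimono[of j _ l] by (force simp: A_def)
    from card_mono[OF fA this] show "width l + hd d - j \<le> u"
      by (simp add: cA)
  next
    assume le: "width l + hd d - j \<le> u"
    show "j \<in> A"
    proof (rule ccontr)
      assume "j \<notin> A"
      then have "length d \<le> full_ht l j"
        using that by (auto simp: A_def)
      then have "A \<subseteq> {Suc j..<width l + hd d}"
      proof (intro subsetI)
        fix i
        assume "i \<in> A"
        then show "i \<in> {Suc j..<width l + hd d}"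
          using full_ht_antimono[of i j l] \<open>length d \<le> full_ht l j\<close>
          by (cases "i \<le> j") (auto simp: A_def)
      qed
      from card_mono[OF _ this] show False
        using le that by (simp add: cA)
    qed
  qed
  have "j \<in> first_row k (width l + hd d) l \<longleftrightarrow> j \<in> A" for j
  proof (cases "j < width l + hd d")
    case True
    then show ?thesis
      using iff[OF True] thresh by (auto simp: first_row_def A_def)
  qed (auto simp: first_row_def A_def)
  then show ?thesis
    unfolding A_def by blast
qed

lemma card_first_row_push: "card (first_row k (width l + hd d) l) = u"
  by (simp add: first_row_push card_active)

lemma row_seq_push: "row_seq k (push (hd d) l) = u # row_seq k l"
  by (simp add: push_def card_first_row_push)

private lemma full_ht_push: "full_ht (push (hd d) l) j = (if j < width l + hd d then 1 else 0) + full_ht l j"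
  by (simp add: push_def)

private lemma col_ht_push:
  "col_ht k (push (hd d) l) j =
     (if j < width l + hd d \<and> full_ht l j < length d then 1 else 0) + col_ht k l j"
  by (simp add: push_def first_row_push)

private lemma base_len_push:
  "base_len k (push (hd d) l) j =
     (if j < width l + hd d \<and> full_ht l j < length d then u else base_len k l j)"
  by (simp only: push_def base_len.simps card_first_row_push) (simp add: first_row_push)

private lemma created: "{j. full_ht l j = 0 \<and> j < width l + hd d} = {width l..<width l + hd d}"
proof (rule set_eqI)
  fix j
  show "j \<in> {j. full_ht l j = 0 \<and> j < width l + hd d} \<longleftrightarrow> j \<in> {width l..<width l + hd d}"
    using pos[of j] by auto
qed

private lemma card_push:
  assumes "1 \<le> h" "h \<le> length d"
  shows "card {j. full_ht l j + 1 = h \<and> j < width l + hd d} = rotate1 d ! (length d - h)"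
proof (cases "h = 1")
  case True
  then show ?thesis
    using created ne by (simp add: nth_rotate1 hd_conv_nth)
next
  case False
  have "{j. full_ht l j + 1 = h \<and> j < width l + hd d} = {j. full_ht l j = h - 1}"
  proof (rule Collect_cong)
    fix j
    show "full_ht l j + 1 = h \<and> j < width l + hd d \<longleftrightarrow> full_ht l j = h - 1"
      using assms False pos[of j] by auto
  qed
  then show ?thesis
    using assms False cnt[of "h - 1"] by (simp add: nth_rotate1 Suc_diff_le)
qed

text \<open>Every active column gains a cell, so the counts move by one place and the
  \<open>hd d\<close> new columns, of height 1, become the last entry. The columns that reach height
  \<open>length d\<close> are finished; their number becomes the new head because a further row of
  length \<open>u\<close> must create as many.\<close>

lemma profile_push: "profile k (push (hd d) l) (rotate1 d)"
proof -
  have xpos: "0 < width l + hd d"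
    using card_active sum by (cases "width l + hd d = 0") auto
  have hd_le: "\<forall>y\<in>set l. y \<le> width l"
    using part by (auto simp: width_def is_partition_def split: list.split)
  have part': "is_partition (push (hd d) l)"
    using part xpos hd_le by (auto simp: push_def is_partition_def)
  moreover have "sorted_wrt (\<ge>) (row_seq k (push (hd d) l))"
    using rows prof by (simp add: row_seq_push profile_def k_shape_iff)
  moreover have "antimono (col_ht k (push (hd d) l))"
  proof (rule antimonoI)
    fix i j :: nat
    assume "i \<le> j"
    have *: "full_ht l j \<le> full_ht l i" "col_ht k l j \<le> col_ht k l i"
      using full_ht_antimono[OF \<open>i \<le> j\<close>] antimonoD[OF anti \<open>i \<le> j\<close>] by auto
    \<comment> \<open>A finished column on the left has height at least \<open>length d\<close>; an
      active one on its right reaches at most this height with the new cell.\<close>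
    show "col_ht k (push (hd d) l) j \<le> col_ht k (push (hd d) l) i"
    proof (cases "full_ht l i < length d")
      case True
      then show ?thesis
        using * low[of i] low[of j] \<open>i \<le> j\<close> by (simp add: col_ht_push)
    next
      case False
      then show ?thesis
        using * high[of i] low[of j] \<open>i \<le> j\<close> by (auto simp: col_ht_push)
    qed
  qed
  moreover have "card {j. full_ht (push (hd d) l) j = h} = rotate1 d ! (length d - h)"
    if "1 \<le> h" "h < length d" for h
  proof -
    have "{j. full_ht (push (hd d) l) j = h} = {j. full_ht l j + 1 = h \<and> j < width l + hd d}"
    proof (rule Collect_cong)
      fix j
      show "full_ht (push (hd d) l) j = h \<longleftrightarrow> full_ht l j + 1 = h \<and> j < width l + hd d"
        using that pos[of j] by (auto simp: full_ht_push)
    qed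
    then show ?thesis
      using card_push that by simp
  qed
  moreover have "full_ht (push (hd d) l) j < length d \<Longrightarrow>
      col_ht k (push (hd d) l) j = full_ht (push (hd d) l) j" for j
    using low[of j] by (auto simp: full_ht_push col_ht_push split: if_splits)
  moreover have "length d \<le> full_ht (push (hd d) l) j \<Longrightarrow>
      length d \<le> col_ht k (push (hd d) l) j" for j
    using low[of j] high[of j] pos[of j] by (auto simp: full_ht_push col_ht_push split: if_splits)
  ultimately show ?thesis
    using ne by (simp add: profile_def k_shape_iff)
qed

lemma ready_push: "ready k u (push (hd d) l) (rotate1 d)"
proof -
  have "sum_list (rotate1 d) = u"
    using sum by (cases d) auto
  then show ?thesis
    using profile_push sum thresh rows by (auto simp: ready_def row_seq_push)
qed

lemma step_count_push_eq:
  "step_count k (push (hd d) l) u (length d) = step_count k l u (length d) + hd (rotate1 d)"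
proof -
  let ?A = "{j. full_ht l j + 1 = length d \<and> j < width l + hd d}"
  let ?B = "{j. base_len k l j = u \<and> col_ht k l j = length d}"
  have fB: "finite ?B"
  proof (rule finite_subset)
    have "j < width l" if "col_ht k l j = length d" for j
      using that col_ht_le_full_ht[of k l j] ne pos[of j] by (cases "full_ht l j = 0") auto
    then show "?B \<subseteq> {..<width l}" by blast
  qed simp
  have "{j. base_len k (push (hd d) l) j = u \<and> col_ht k (push (hd d) l) j = length d} = ?A \<union> ?B"
  proof (rule set_eqI)
    fix j
    show "j \<in> {j. base_len k (push (hd d) l) j = u \<and> col_ht k (push (hd d) l) j = length d} \<longleftrightarrow>
          j \<in> ?A \<union> ?B"
      using low[of j] ne by (cases "full_ht l j < length d") (auto simp: base_len_push col_ht_push)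
  qed
  moreover have "?A \<inter> ?B = {}"
    using low by auto
  ultimately have "step_count k (push (hd d) l) u (length d) = card ?A + card ?B"
    using fB by (simp add: step_count_def card_Un_disjoint)
  moreover have "card ?A = hd (rotate1 d)"
    using card_push[of "length d"] ne by (simp add: hd_conv_nth Suc_le_eq)
  ultimately show ?thesis
    by (simp add: step_count_def)
qed

text \<open>Every active column is met by the row just added, so its base length is now
  \<open>u\<close>, whatever it was before.\<close>

lemma step_count_push_less:
  assumes "1 \<le> v" "v < length d"
  shows "step_count k (push (hd d) l) u v = rotate1 d ! (length d - v)"
proof -
  have "{j. base_len k (push (hd d) l) j = u \<and> col_ht k (push (hd d) l) j = v} =
        {j. full_ht l j + 1 = v \<and> j < width l + hd d}"
  proof (rule Collect_cong)
    fix j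
    show "base_len k (push (hd d) l) j = u \<and> col_ht k (push (hd d) l) j = v \<longleftrightarrow>
          full_ht l j + 1 = v \<and> j < width l + hd d"
      using assms low[of j] high[of j] pos[of j]
      by (cases "full_ht l j < length d"; cases "j < width l + hd d")
        (auto simp: base_len_push col_ht_push)
  qed
  then show ?thesis
    using card_push assms by (simp add: step_count_def)
qed

lemma step_count_push_greater:
  assumes "length d < v"
  shows "step_count k (push (hd d) l) u v = step_count k l u v"
proof -
  have "base_len k (push (hd d) l) j = u \<and> col_ht k (push (hd d) l) j = v \<longleftrightarrow>
        base_len k l j = u \<and> col_ht k l j = v" for j
    using assms low[of j] by (auto simp: base_len_push col_ht_push)
  then show ?thesis
    by (simp only: step_count_def)
qed

lemma full_ht_ge_iff: "length d \<le> full_ht l j \<longleftrightarrow> j + u < width l + hd d"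
proof (cases "j < width l + hd d")
  case True
  then show ?thesis
    using mem_first_row_iff[of j k "width l + hd d" l]
    by (simp add: card_first_row_push) (auto simp: first_row_push)
next
  case False
  then show ?thesis
    using pos[of j] ne by (auto simp: Suc_le_eq)
qed

lemma tall_push_iff:
  "(\<exists>j\<in>first_row k (width l + hd d) l. col_ht k (push (hd d) l) j = length d) \<longleftrightarrow>
     0 < hd (rotate1 d)"
proof -
  let ?A = "{j. full_ht l j + 1 = length d \<and> j < width l + hd d}"
  have "card ?A = hd (rotate1 d)"
    using card_push[of "length d"] ne by (simp add: hd_conv_nth Suc_le_eq)
  then have "0 < hd (rotate1 d) \<longleftrightarrow> ?A \<noteq> {}"
    by (metis (no_types, lifting) card_gt_0_iff finite_nat_set_iff_bounded mem_Collect_eq)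
  also have "\<dots> \<longleftrightarrow> (\<exists>j\<in>first_row k (width l + hd d) l. col_ht k (push (hd d) l) j = length d)"
    using low by (force simp: first_row_push col_ht_push)
  finally show ?thesis ..
qed

lemma u_le_width: "u \<le> width l + hd d"
  using card_first_row_le[of k "width l + hd d" l] by (simp add: card_first_row_push)

end

section \<open>Several rows of one length, and the change of regime\<close>

primrec add_rows :: "nat \<Rightarrow> nat list \<Rightarrow> nat list \<Rightarrow> nat list" where
  "add_rows 0 d l = l"
| "add_rows (Suc n) d l = push (hd (rotate n d)) (add_rows n d l)"

text \<open>Lowering the threshold by one: the \<open>b\<close> columns of height
  \<open>length d - 1\<close> become finished, and the next row must create \<open>b\<close> further
  columns to keep its length.\<close>

fun merge :: "nat list \<Rightarrow> nat list" where
  "merge (a # b # d) = (a + b) # d"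
| "merge d = d"

text \<open>Passage from row length \<open>u - 1\<close> to \<open>u\<close>: the next row creates
  one more column. A profile constrains only the entries after the head.\<close>

fun inc :: "nat list \<Rightarrow> nat list" where
  "inc (a # d) = Suc a # d"
| "inc [] = []"

lemma length_inc [simp]: "length (inc d) = length d"
  by (cases d) auto

lemma sum_list_inc: "0 < length d \<Longrightarrow> sum_list (inc d) = Suc (sum_list d)"
  by (cases d) auto

lemma hd_inc: "0 < length d \<Longrightarrow> hd (inc d) = Suc (hd d)"
  by (cases d) auto

lemma length_merge: "2 \<le> length d \<Longrightarrow> length (merge d) = length d - 1"
  by (cases d rule: merge.cases) auto

lemma sum_list_merge [simp]: "sum_list (merge d) = sum_list d"
  by (cases d rule: merge.cases) auto

lemma sum_list_rotate [simp]: "sum_list (rotate n d) = sum_list (d :: nat list)"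
proof (induction n)
  case (Suc n)
  have "sum_list (rotate1 e) = sum_list e" for e :: "nat list"
    by (cases e) auto
  with Suc show ?case
    by simp
qed simp

lemma profile_inc: "profile k l d \<Longrightarrow> profile k l (inc d)"
  by (cases d) (auto simp: profile_def nth_Cons')

lemma profile_merge:
  assumes "profile k l d" "2 \<le> length d"
  shows "profile k l (merge d)"
proof -
  obtain a b r where d: "d = a # b # r"
    using assms(2) by (cases d rule: merge.cases) auto
  have "col_ht k l j = full_ht l j" if "full_ht l j < Suc (length r)" for j
    using assms(1) that by (simp add: profile_def d)
  moreover have "Suc (length r) \<le> col_ht k l j" if "Suc (length r) \<le> full_ht l j" for j
    using assms(1) that unfolding profile_def d
    by (cases "full_ht l j = Suc (length r)") (auto dest!: spec[of _ j])
  moreover have "card {j. full_ht l j = h} = ((a + b) # r) ! (Suc (length r) - h)"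
    if "h \<in> {1..<Suc (length r)}" for h
    using assms(1) that unfolding profile_def d by (auto simp: nth_Cons' Suc_diff_le)
  ultimately show ?thesis
    using assms(1) by (simp add: profile_def d)
qed

context
  fixes k u :: nat and l d :: "nat list"
  assumes ready: "ready k u l d"
begin

lemma ready_add_rows: "ready k u (add_rows n d l) (rotate n d)"
  by (induction n) (auto simp: ready ready_push)

lemma row_seq_add_rows: "row_seq k (add_rows n d l) = replicate n u @ row_seq k l"
  by (induction n) (auto simp: row_seq_push[OF ready_add_rows])

lemma hd_rotate1_rotate: "hd (rotate1 (rotate n d)) = d ! (Suc n mod length d)"
proof -
  have "d \<noteq> []"
    using ready by (auto simp: ready_def)
  then show ?thesis
    using hd_rotate_conv_nth[of d "Suc n"] by simp
qed

lemma step_count_add_rows_eq: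
  "step_count k (add_rows n d l) u (length d) =
     step_count k l u (length d) + (\<Sum>r<n. d ! (Suc r mod length d))"
proof (induction n)
  case (Suc n)
  then show ?case
    using step_count_push_eq[OF ready_add_rows[of n]] by (simp add: hd_rotate1_rotate)
qed simp

lemma step_count_add_rows_less:
  assumes "1 \<le> v" "v < length d"
  shows "step_count k (add_rows (Suc n) d l) u v = rotate (Suc n) d ! (length d - v)"
  using step_count_push_less[OF ready_add_rows[of n]] assms by simp

lemma step_count_add_rows_greater:
  "length d < v \<Longrightarrow> step_count k (add_rows n d l) u v = step_count k l u v"
proof (induction n)
  case (Suc n)
  then show ?case
    using step_count_push_greater[OF ready_add_rows[of n]] by simp
qed simp

lemma step_count_add_rows_other:
  assumes "u' < u" "k \<le> u' + v"
  shows "step_count k (add_rows n d l) u' v = step_count k l u' v"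
proof (induction n)
  case (Suc n)
  have "step_count k (push (hd (rotate n d)) (add_rows n d l)) u' v =
        step_count k (add_rows n d l) u' v"
    unfolding push_def
    using assms card_first_row_push[OF ready_add_rows[of n]] by (intro step_count_Cons_gt) auto
  with Suc show ?case
    by simp
qed simp

end

lemma sum_nth_Suc_mod: "(\<Sum>r<length d. d ! (Suc r mod length d)) = sum_list (d :: nat list)"
proof (cases d)
  case (Cons a r)
  have "(\<Sum>i<length r. d ! (Suc i mod length d)) = (\<Sum>i<length r. r ! i)"
    by (rule sum.cong) (auto simp: Cons)
  moreover have "sum_list r = (\<Sum>i<length r. r ! i)"
    by (simp add: sum_list_sum_nth atLeast0LessThan)
  ultimately show ?thesis
    unfolding Cons length_Cons sum.lessThan_Suc by simp
qed simp

text \<open>The indices start at 1, so the head is reached only at the end of a full turn. With a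
  positive head, stopping earlier keeps the sum below \<open>sum_list d\<close>, which is the bound
  \<open>u - 1\<close>.\<close>

lemma sum_nth_Suc_mod_less:
  assumes "n < length d"
  shows "(\<Sum>r<n. d ! (Suc r mod length d)) + hd d \<le> sum_list (d :: nat list)"
proof -
  obtain a r where d: "d = a # r"
    using assms by (cases d) auto
  have "(\<Sum>i<n. d ! (Suc i mod length d)) \<le> (\<Sum>i<length r. d ! (Suc i mod length d))"
    using assms by (intro sum_mono2) (auto simp: d)
  moreover have "(\<Sum>i<length r. d ! (Suc i mod length d)) + hd d = sum_list d"
    unfolding sum_nth_Suc_mod[symmetric] by (simp add: d)
  ultimately show ?thesis
    by simp
qed

context
  fixes k u x y :: nat and l d :: "nat list"
  assumes ready: "ready k u l d" and lax: "length d + u = k + 1" and len: "2 \<le> length d"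
    and new: "u \<notin> set (row_seq k l)" and hd_pos: "0 < hd d"
begin

abbreviation "grown \<equiv> add_rows y (merge (rotate x d)) (add_rows x d l)"

private lemma upos: "0 < u"
  using ready by (simp add: ready_def)

lemma ready_merge: "ready k u (add_rows x d l) (merge (rotate x d))"
proof -
  have "profile k (add_rows x d l) (merge (rotate x d))"
    using ready_add_rows[OF ready, of x] len by (auto simp: ready_def intro: profile_merge)
  moreover have "length (merge (rotate x d)) + u = k"
    using lax len by (simp add: length_merge)
  ultimately show ?thesis
    using ready_add_rows[OF ready, of x] by (auto simp: ready_def)
qed

lemma ready_grown: "ready k u grown (rotate y (merge (rotate x d)))"
  by (rule ready_add_rows[OF ready_merge])

lemma row_seq_grown: "row_seq k grown = replicate (y + x) u @ row_seq k l"
  by (simp add: row_seq_add_rows[OF ready_merge] row_seq_add_rows[OF ready] replicate_add)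

lemma step_count_grown_lax:
  "step_count k grown u (k + 1 - u) = (\<Sum>r<x. d ! (Suc r mod length d))"
proof -
  have "length (merge (rotate x d)) < k + 1 - u" "k + 1 - u = length d"
    using lax len by (simp_all add: length_merge)
  then show ?thesis
    using step_count_add_rows_greater[OF ready_merge] step_count_add_rows_eq[OF ready]
      step_count_eq_0[of u k l] upos new by simp
qed

text \<open>The merge itself finishes the columns of height \<open>k - u\<close>, counted by entry
  1. They have base length \<open>u\<close> only if a row of length \<open>u\<close> has already
  been added, hence the case \<open>x = 0\<close>.\<close>

lemma step_count_grown_strict:
  "step_count k grown u (k - u) =
     (if x = 0 then 0 else rotate x d ! 1) +
     (\<Sum>r<y. merge (rotate x d) ! (Suc r mod (length d - 1)))"
proof -
  have v: "k - u = length d - 1" "length (merge (rotate x d)) = length d - 1"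
    using lax len by (simp_all add: length_merge)
  have "step_count k (add_rows x d l) u (length d - 1) = (if x = 0 then 0 else rotate x d ! 1)"
  proof (cases x)
    case 0
    then show ?thesis
      using step_count_eq_0[of u k l] upos new by simp
  next
    case (Suc n)
    then show ?thesis
      using step_count_add_rows_less[OF ready, of "length d - 1" n] len by simp
  qed
  then show ?thesis
    using step_count_add_rows_eq[OF ready_merge, of y] v by simp
qed

lemma step_count_grown_other:
  "u' < u \<Longrightarrow> k \<le> u' + v \<Longrightarrow> step_count k grown u' v = step_count k l u' v"
  by (simp add: step_count_add_rows_other[OF ready_merge] step_count_add_rows_other[OF ready])

end

section \<open>Codes of irreducible shapes\<close>

text \<open>A code lists, from the longest rows to the shortest, one pair \<open>(x, y)\<close> for each row length
  \<open>u\<close>: first come \<open>x\<close> rows during which a column may reach height \<open>k + 1 - u\<close>, then \<open>y\<close> rows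
  during which columns are finished at height \<open>k - u\<close>. Merging the first two entries of the state
  realises the change of regime. The bounds in \<open>valid\<close> express irreducibility, and \<open>0 < inc (state k cs) ! x\<close>
  makes \<open>x\<close> unique: the last of the \<open>x\<close> rows meets a column of height \<open>k + 1 - u\<close>.\<close>

fun state :: "nat \<Rightarrow> (nat \<times> nat) list \<Rightarrow> nat list" where
  "state k [] = replicate k 0"
| "state k ((x, y) # cs) = rotate y (merge (rotate x (inc (state k cs))))"

fun shape :: "nat \<Rightarrow> (nat \<times> nat) list \<Rightarrow> nat list" where
  "shape k [] = []"
| "shape k ((x, y) # cs) =
     add_rows y (merge (rotate x (inc (state k cs)))) (add_rows x (inc (state k cs)) (shape k cs))"

fun valid :: "nat \<Rightarrow> (nat \<times> nat) list \<Rightarrow> bool" where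
  "valid k [] \<longleftrightarrow> True"
| "valid k ((x, y) # cs) \<longleftrightarrow> valid k cs \<and>
     x < length (state k cs) \<and> 0 < inc (state k cs) ! x \<and> Suc y < length (state k cs)"

lemma length_state: "valid k cs \<Longrightarrow> length (state k cs) = k - length cs"
proof (induction cs)
  case (Cons c cs)
  then show ?case
    by (cases c) (auto simp: length_merge)
qed simp

lemma sum_list_state: "valid k cs \<Longrightarrow> sum_list (state k cs) = length cs"
proof (induction cs)
  case (Cons c cs)
  then show ?case
    by (cases c) (auto simp: sum_list_inc[OF order.strict_trans1[OF zero_le]])
qed (simp add: sum_list_replicate)

lemma profile_Nil: "0 < k \<Longrightarrow> profile k [] (replicate k 0)"
  by (auto simp: profile_def k_shape_def is_partition_def col_seq_def)

lemma shape_invariant: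
  "valid k cs \<Longrightarrow> 0 < k \<Longrightarrow>
     profile k (shape k cs) (state k cs) \<and> (\<forall>r\<in>set (row_seq k (shape k cs)). r \<le> length cs)"
proof (induction cs)
  case Nil
  then show ?case
    by (simp add: profile_Nil)
next
  case (Cons c cs)
  obtain x y where c: "c = (x, y)"
    by (cases c)
  let ?d = "inc (state k cs)" and ?u = "Suc (length cs)"
  have val: "valid k cs" "Suc y < length (state k cs)"
    using Cons.prems by (auto simp: c)
  have len: "length ?d = k - length cs"
    using val by (simp add: length_state)
  have rdy: "ready k ?u (shape k cs) ?d"
    using Cons val len by (auto simp: ready_def sum_list_state sum_list_inc profile_inc)
  have "u \<le> length cs" if "u \<in> set (row_seq k (shape k cs))" for u
    using Cons val that by auto
  then have new: "?u \<notin> set (row_seq k (shape k cs))"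
    by force
  have "ready k ?u (shape k (c # cs)) (state k (c # cs))"
    using ready_grown[OF rdy _ _ new, where x = x and y = y] val len by (simp add: c hd_inc)
  then show ?case
    by (auto simp: ready_def)
qed

context
  fixes k x y :: nat and cs :: "(nat \<times> nat) list"
  assumes val: "valid k ((x, y) # cs)"
begin

private lemma val': "valid k cs" "0 < k" "x < length (state k cs)" "Suc y < length (state k cs)"
    "0 < inc (state k cs) ! x" "length (state k cs) = k - length cs"
  using val by (auto simp: length_state)

private lemma phase_facts:
  shows "ready k (Suc (length cs)) (shape k cs) (inc (state k cs))"
    "length (inc (state k cs)) + Suc (length cs) = k + 1"
    "2 \<le> length (inc (state k cs))"
    "Suc (length cs) \<notin> set (row_seq k (shape k cs))"
    "0 < hd (inc (state k cs))"
  using shape_invariant[OF val'(1,2)] val'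
  by (auto simp: ready_def sum_list_state sum_list_inc profile_inc hd_inc)

lemmas row_seq_phase = row_seq_grown[OF phase_facts, of y x, folded shape.simps]
  and step_count_lax_phase = step_count_grown_lax[OF phase_facts, of y x, folded shape.simps]
  and step_count_strict_phase = step_count_grown_strict[OF phase_facts, of y x, folded shape.simps]
  and step_count_other_phase = step_count_grown_other[OF phase_facts, of _ _ y x, folded shape.simps]

end

lemma step_count_valid_le:
  "valid k cs \<Longrightarrow> u \<in> {1..length cs} \<Longrightarrow>
     step_count k (shape k cs) u (k - u) \<le> u - 1 \<and> step_count k (shape k cs) u (k + 1 - u) \<le> u - 1"
proof (induction cs)
  case (Cons c cs)
  obtain x y where c: "c = (x, y)"
    by (cases c)
  note val = Cons.prems(1)[unfolded c]
  let ?d = "inc (state k cs)"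
  let ?e = "merge (rotate x ?d)"
  have v: "valid k cs" "x < length ?d" "Suc y < length ?d" "0 < ?d ! x" "length ?d = k - length cs"
    using val by (auto simp: length_state)
  have sums: "sum_list ?d = Suc (length cs)" "sum_list ?e = Suc (length cs)"
    using v by (simp_all add: sum_list_state sum_list_inc)
  show ?case
  proof (cases "u = Suc (length cs)")
    case True
    have "0 < hd ?d"
      using v by (simp add: hd_inc)
    then have "step_count k (shape k ((x, y) # cs)) u (k + 1 - u) \<le> u - 1"
      using step_count_lax_phase[OF val] sum_nth_Suc_mod_less[OF v(2)] sums by (simp add: True)
    moreover have "step_count k (shape k ((x, y) # cs)) u (k - u) \<le> u - 1"
    proof -
      \<comment> \<open>Here \<open>a\<close> is \<open>?d ! x\<close>, hence positive. The merge
        contributes at most \<open>b\<close>, and the sum over the \<open>y\<close> strict rows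
        misses the merged head \<open>a + b\<close>, so the total is at most
        \<open>u - a\<close>.\<close>
      obtain a b r where abr: "rotate x ?d = a # b # r"
        using v(3) by (metis length_rotate merge.cases length_Cons list.size(3) not_less_eq not_less_zero less_SucE One_nat_def Suc_lessD)
      have "a = ?d ! x"
        using hd_rotate_conv_nth[of ?d x] v(2) unfolding abr by fastforce
      moreover have "y < length ?e"
        using v length_merge[of "rotate x ?d"] by simp
      note sum_nth_Suc_mod_less[OF this]
      moreover have "length ?e = length ?d - 1"
        using v length_merge[of "rotate x ?d"] by simp
      ultimately show ?thesis
        using step_count_strict_phase[OF val] sums v by (simp add: True abr)
    qed
    ultimately show ?thesis
      by (simp add: c)
  next
    case False
    then show ?thesis
      using Cons.IH[OF v(1)] Cons.prems(2) step_count_other_phase[OF val, of u] by (simp add: c)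
  qed
qed simp

lemma valid_shape_irreducible:
  assumes "valid k cs" "length cs = k - 1" "0 < k"
  shows "shape k cs \<in> irreducible_k_shapes k"
proof -
  have inv: "profile k (shape k cs) (state k cs)" "\<forall>r\<in>set (row_seq k (shape k cs)). r \<le> k - 1"
    using shape_invariant[OF assms(1,3)] assms(2) by simp_all
  have "step_count k (shape k cs) u (k - u) \<le> u - 1 \<and> step_count k (shape k cs) u (k + 1 - u) \<le> u - 1"
    if "u \<in> {1..k}" for u
  proof (cases "u = k")
    case True
    have "u \<notin> set (row_seq k (shape k cs))"
      using inv(2) assms(3) True by force
    then show ?thesis
      using step_count_eq_0[of u k "shape k cs"] that by simp
  next
    case False
    then show ?thesis
      using that assms by (intro step_count_valid_le) auto
  qed
  then show ?thesis
    using inv(1) by (simp add: irreducible_k_shapes_def card_h_steps profile_def)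
qed

text \<open>The number of rows of length \<open>u\<close> is \<open>x + y\<close>, and the count at
  height \<open>k + 1 - u\<close> is a partial sum along the word. Such sums increase strictly on
  reaching a positive entry, so positivity at position \<open>x\<close> lets the count determine
  \<open>x\<close>. Shorter row lengths have frozen counts, which gives the induction.\<close>

lemma valid_eqI:
  assumes "valid k cs" "valid k cs'" "length cs = length cs'"
    and "\<And>u. u \<in> {1..length cs} \<Longrightarrow>
      step_count k (shape k cs) u (k + 1 - u) = step_count k (shape k cs') u (k + 1 - u) \<and>
      count_list (row_seq k (shape k cs)) u = count_list (row_seq k (shape k cs')) u"
  shows "cs = cs'"
  using assms(3,1,2,4)
proof (induction cs cs' rule: list_induct2)
  case (Cons c cs c' cs')
  obtain x y x' y' where c: "c = (x, y)" "c' = (x', y')"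
    by (cases c, cases c')
  note val = Cons.prems(1)[unfolded c] and val' = Cons.prems(2)[unfolded c]
  note eq = Cons.prems(3)[unfolded c]
  have "cs = cs'"
  proof (rule Cons.IH)
    fix u
    assume u: "u \<in> {1..length cs}"
    show "step_count k (shape k cs) u (k + 1 - u) = step_count k (shape k cs') u (k + 1 - u) \<and>
      count_list (row_seq k (shape k cs)) u = count_list (row_seq k (shape k cs')) u"
      using eq[of u] u Cons.hyps step_count_other_phase[OF val, of u "k + 1 - u"]
        step_count_other_phase[OF val', of u "k + 1 - u"]
      by (simp add: row_seq_phase[OF val] row_seq_phase[OF val'] del: shape.simps)
  qed (use val val' in auto)
  let ?d = "inc (state k cs)"
  let ?S = "\<lambda>n. \<Sum>r<n. ?d ! (Suc r mod length ?d)"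
  have less: "?S a < ?S b" if "a < b" "b < length ?d" "0 < ?d ! b" for a b
  proof -
    obtain b' where b': "b = Suc b'"
      using \<open>a < b\<close> by (cases b) auto
    have "?S a \<le> ?S b'"
      using that b' by (intro sum_mono2) auto
    then show ?thesis
      using that by (simp add: b')
  qed
  have "?S x = ?S x'"
    using eq[of "Suc (length cs)"] step_count_lax_phase[OF val] step_count_lax_phase[OF val'] \<open>cs = cs'\<close>
    by (simp del: shape.simps)
  then have "x = x'"
    using less[of x x'] less[of x' x] val val' \<open>cs = cs'\<close> by (cases x x' rule: linorder_cases) auto
  moreover have "y + x = y' + x'"
  proof -
    have "count_list (replicate n a) a = n" for n and a :: nat
      by (induction n) auto
    then show ?thesis
      using eq[of "Suc (length cs)"] \<open>cs = cs'\<close>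
      unfolding row_seq_phase[OF val] row_seq_phase[OF val'] by simp
  qed
  ultimately show ?case
    using \<open>cs = cs'\<close> by (simp add: c)
qed simp

lemma inj_on_shape: "inj_on (shape k) {cs. valid k cs \<and> length cs = n}"
  by (rule inj_onI) (auto intro!: valid_eqI[of k])

text \<open>A code starts with the longest rows, so entry \<open>n\<close> has row length
  \<open>length cs - n\<close>. For \<open>x > 0\<close> the last term of the count is the positive
  entry at position \<open>x\<close>.\<close>

lemma step_count_shape_eq_0_iff:
  "valid k cs \<Longrightarrow> n < length cs \<Longrightarrow>
     step_count k (shape k cs) (length cs - n) (k + 1 - (length cs - n)) = 0 \<longleftrightarrow> fst (cs ! n) = 0"
proof (induction cs arbitrary: n)
  case (Cons c cs)
  obtain x y where c: "c = (x, y)"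
    by (cases c)
  note val = Cons.prems(1)[unfolded c]
  show ?case
  proof (cases n)
    case 0
    have "(\<Sum>r<x. inc (state k cs) ! (Suc r mod length (inc (state k cs)))) = 0 \<longleftrightarrow> x = 0"
      using val by (cases x) auto
    then show ?thesis
      using step_count_lax_phase[OF val] by (simp add: c 0 del: shape.simps)
  next
    case (Suc n')
    then show ?thesis
      using Cons.IH[of n'] Cons.prems val step_count_other_phase[OF val, of "length cs - n'" "k + 1 - (length cs - n')"]
      by (simp add: c del: shape.simps)
  qed
qed simp

section \<open>Decoding: recovering the rotation amounts from a shape\<close>

lemma card_first_row_le_k: "card (first_row k x l) \<le> k"
proof (cases "card (first_row k x l) = 0")
  case False
  then have "x - card (first_row k x l) \<in> first_row k x l"
    using card_first_row_le[of k x l] mem_first_row_iff[of "x - card (first_row k x l)" k x l] by linarith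
  then show ?thesis
    using card_first_row_le[of k x l] by (simp add: first_row_def[of k x l])
qed simp

text \<open>\<open>tall\<close> and \<open>closed_low\<close> are the witnesses of the two regimes:
  the bottom row met a column that had height \<open>k - u\<close>, or a column of height
  \<open>k - u\<close> was left behind to the left of the last \<open>u\<close> columns.\<close>

definition tall :: "nat \<Rightarrow> nat \<Rightarrow> nat list \<Rightarrow> bool" where
  "tall k u l \<longleftrightarrow> (case l of [] \<Rightarrow> False | x # l' \<Rightarrow> \<exists>j\<in>first_row k x l'. col_ht k l j = k + 1 - u)"

definition closed_low :: "nat \<Rightarrow> nat \<Rightarrow> nat list \<Rightarrow> bool" where
  "closed_low k u l \<longleftrightarrow> (\<exists>j. j + u < width l \<and> col_ht k l j = k - u)"

context
  fixes k u x :: nat and l d :: "nat list"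
  assumes ready: "ready k u l d" and card: "card (first_row k x l) = u"
begin

private lemma le: "u \<le> x" "0 < u" "u \<le> width l + hd d"
  using card_first_row_le[of k x l] card ready u_le_width[OF ready] by (auto simp: ready_def)

private lemma start: "x - u \<in> first_row k x l"
  using le card by (subst mem_first_row_iff) simp

private lemma start_le: "u + full_ht l (x - u) \<le> k"
  using start le by (simp add: first_row_def)

private lemma before_start: "u < x \<Longrightarrow> k < u + 1 + full_ht l (x - u - 1) \<and> x - u - 1 \<notin> first_row k x l"
  using mem_first_row_iff[of "x - u - 1" k x l] le card by (auto simp: first_row_def[of k x l])

text \<open>The hook lengths around the first cell of the row leave open only whether a column of
  height \<open>k - u\<close> is met. Without a tall column it is not, so the row starts exactly at
  the first column below the threshold, which \<open>full_ht_ge_iff\<close> locates.\<close>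

lemma eq_push_if_not_tall:
  assumes "length d + u = k" "\<not> tall k u (x # l)"
  shows "x # l = push (hd d) l"
proof -
  have "\<not> length d \<le> full_ht l (x - u)"
  proof
    assume "length d \<le> full_ht l (x - u)"
    then have "full_ht l (x - u) = k - u" "length d \<le> col_ht k l (x - u)"
      using start_le assms(1) ready by (auto simp: ready_def profile_def)
    moreover have "col_ht k l (x - u) \<le> full_ht l (x - u)"
      by (rule col_ht_le_full_ht)
    ultimately have "col_ht k (x # l) (x - u) = k + 1 - u"
      using start assms(1) by simp
    with assms(2) start show False
      by (auto simp: tall_def)
  qed
  moreover have "u < x \<Longrightarrow> length d \<le> full_ht l (x - u - 1)"
    using before_start assms(1) by auto
  ultimately have "x = width l + hd d"
    unfolding full_ht_ge_iff[OF ready] using le by (cases "u < x") auto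
  then show ?thesis
    by (simp add: push_def)
qed

lemma eq_push_if_not_closed_low:
  assumes "length d + u = k + 1" "\<not> closed_low k u (x # l)"
  shows "x # l = push (hd d) l"
proof -
  have "\<not> length d \<le> full_ht l (x - u)"
    using start_le assms(1) by auto
  moreover have "length d \<le> full_ht l (x - u - 1)" if "u < x"
  proof (rule ccontr)
    assume *: "\<not> length d \<le> full_ht l (x - u - 1)"
    then have "full_ht l (x - u - 1) = k - u" "col_ht k l (x - u - 1) = full_ht l (x - u - 1)"
      using before_start[OF that] assms(1) ready by (auto simp: ready_def profile_def)
    then have "col_ht k (x # l) (x - u - 1) = k - u"
      using before_start[OF that] by simp
    moreover have "x - u - 1 + u < width (x # l)"
      using that by (simp add: width_def)
    ultimately show False
      using assms(2) unfolding closed_low_def by blast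
  qed
  ultimately have "x = width l + hd d"
    unfolding full_ht_ge_iff[OF ready] using le by (cases "u < x") auto
  then show ?thesis
    by (simp add: push_def)
qed

end

text \<open>The column left behind lies to the left of the bottom row's boundary cells, so heights
  \<open>k - u\<close> and then \<open>k + 1 - u\<close> would increase. This forces all lax rows to
  come before the strict ones.\<close>

lemma not_closed_low_if_tall:
  assumes "k_shape k (x # l)" "card (first_row k x l) = u" "u \<le> k" "tall k u (x # l)"
  shows "\<not> closed_low k u (x # l)"
proof
  assume "closed_low k u (x # l)"
  then obtain j where j: "j + u < x" "col_ht k (x # l) j = k - u"
    by (auto simp: closed_low_def width_def)
  obtain j' where j': "j' \<in> first_row k x l" "col_ht k (x # l) j' = k + 1 - u"
    using assms(4) by (auto simp: tall_def)
  have "j \<le> j'"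
    using j'(1) j(1) assms(2) mem_first_row_iff[of j' k x l] by auto
  then have "col_ht k (x # l) j' \<le> col_ht k (x # l) j"
    using assms(1) by (auto simp: k_shape_iff dest: antimonoD)
  with j j' assms(3) show False
    by linarith
qed

lemma closed_low_Cons:
  assumes "is_partition (x # l)" "card (first_row k x l) = u" "closed_low k u l"
  shows "closed_low k u (x # l)"
proof -
  obtain j where j: "j + u < width l" "col_ht k l j = k - u"
    using assms(3) by (auto simp: closed_low_def)
  have "width l \<le> x"
    using assms(1) by (auto simp: is_partition_def width_def split: list.split)
  then have "j \<notin> first_row k x l" "j + u < x"
    using j assms(2) mem_first_row_iff[of j k x l] by auto
  then show ?thesis
    using j by (auto simp: closed_low_def width_def)
qed

lemma k_shape_append: "k_shape k (ys @ l) \<Longrightarrow> k_shape k l"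
  by (induction ys) (auto dest: k_shape_Cons)

lemma eq_add_rows_lax:
  assumes "ready k u l d" "length d + u = k + 1"
  shows "k_shape k (ys @ l) \<Longrightarrow> row_seq k (ys @ l) = replicate (length ys) u @ row_seq k l \<Longrightarrow>
    \<not> closed_low k u (ys @ l) \<Longrightarrow> ys @ l = add_rows (length ys) d l"
proof (induction ys)
  case (Cons y ys)
  have card: "card (first_row k y (ys @ l)) = u"
    using Cons.prems(2) by simp
  have "\<not> closed_low k u (ys @ l)"
    using closed_low_Cons[OF _ card] Cons.prems by (auto simp: k_shape_iff)
  then have IH: "ys @ l = add_rows (length ys) d l"
    using Cons by (auto dest: k_shape_Cons)
  have "ready k u (ys @ l) (rotate (length ys) d)"
    unfolding IH by (rule ready_add_rows[OF assms(1)])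
  from eq_push_if_not_closed_low[OF this card] show ?case
    using assms(2) Cons.prems IH by simp
qed simp

text \<open>While \<open>closed_low\<close> persists when rows of length \<open>u\<close> are added,
  \<open>tall\<close> looks only at the bottom row, so its absence is demanded at every row.\<close>

fun never_tall :: "nat \<Rightarrow> nat \<Rightarrow> nat list \<Rightarrow> nat list \<Rightarrow> bool" where
  "never_tall k u l [] \<longleftrightarrow> True"
| "never_tall k u l (y # ys) \<longleftrightarrow> \<not> tall k u (y # ys @ l) \<and> never_tall k u l ys"

lemma eq_add_rows_strict:
  assumes "ready k u l d" "length d + u = k"
  shows "row_seq k (ys @ l) = replicate (length ys) u @ row_seq k l \<Longrightarrow>
    never_tall k u l ys \<Longrightarrow> ys @ l = add_rows (length ys) d l"
proof (induction ys)
  case (Cons y ys)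
  have card: "card (first_row k y (ys @ l)) = u"
    using Cons.prems(1) by simp
  have IH: "ys @ l = add_rows (length ys) d l"
    using Cons by auto
  have "ready k u (ys @ l) (rotate (length ys) d)"
    unfolding IH by (rule ready_add_rows[OF assms(1)])
  from eq_push_if_not_tall[OF this card] show ?case
    using assms(2) Cons.prems IH by simp
qed simp

lemma last_tall:
  obtains zs ws where "ys = zs @ ws" "ws = [] \<or> tall k u (ws @ l)" "never_tall k u (ws @ l) zs"
proof -
  have "\<exists>zs ws. ys = zs @ ws \<and> (ws = [] \<or> tall k u (ws @ l)) \<and> never_tall k u (ws @ l) zs"
  proof (induction ys)
    case (Cons y ys)
    then obtain zs ws where *: "ys = zs @ ws" "ws = [] \<or> tall k u (ws @ l)" "never_tall k u (ws @ l) zs"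
      by blast
    show ?case
    proof (cases "tall k u (y # ys @ l)")
      case True
      then show ?thesis
        by (intro exI[of _ "[]"] exI[of _ "y # ys"]) auto
    next
      case False
      then show ?thesis
        using * by (intro exI[of _ "y # zs"] exI[of _ ws]) auto
    qed
  qed auto
  then show ?thesis
    using that by blast
qed

lemma row_seq_append_dest:
  "row_seq k (ys @ l) = replicate (length ys) u @ row_seq k l \<Longrightarrow> ys = zs @ ws \<Longrightarrow>
     row_seq k (ws @ l) = replicate (length ws) u @ row_seq k l \<and>
     row_seq k (zs @ ws @ l) = replicate (length zs) u @ row_seq k (ws @ l)"
proof (induction zs arbitrary: ys)
  case (Cons z zs)
  then show ?case
    by (cases ys) auto
qed simp

lemma decode_phase:
  assumes ready: "ready k u l d" and lax: "length d + u = k + 1" and len: "2 \<le> length d"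
    and new: "u \<notin> set (row_seq k l)" and hd_pos: "0 < hd d"
    and shape: "k_shape k (ys @ l)"
    and rows: "row_seq k (ys @ l) = replicate (length ys) u @ row_seq k l"
    and bounds: "step_count k (ys @ l) u (k + 1 - u) < u" "step_count k (ys @ l) u (k - u) < u"
  shows "\<exists>x y. ys @ l = add_rows y (merge (rotate x d)) (add_rows x d l) \<and>
    x < length d \<and> 0 < d ! x \<and> Suc y < length d"
proof -
  obtain zs ws where split: "ys = zs @ ws" "ws = [] \<or> tall k u (ws @ l)" "never_tall k u (ws @ l) zs"
    by (rule last_tall)
  define x where "x = length ws"
  define y where "y = length zs"
  define e where "e = merge (rotate x d)"
  note rows' = row_seq_append_dest[OF rows split(1)]
  have shape': "k_shape k (ws @ l)"
    using shape k_shape_append[of k zs "ws @ l"] by (simp add: split(1))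
  have u: "u \<le> k" "0 < u" "sum_list d = u"
    using ready lax len by (auto simp: ready_def)
  have ws: "ws @ l = add_rows x d l"
  proof (cases ws)
    case (Cons w ws')
    \<comment> \<open>The bottom row of \<open>ws\<close> is tall, and this single row certifies the
      whole of \<open>ws\<close> as lax.\<close>
    have "\<not> closed_low k u (ws @ l)"
      using not_closed_low_if_tall[of k w "ws' @ l" u] shape' rows' u split(2) by (simp add: Cons)
    then show ?thesis
      unfolding x_def using eq_add_rows_lax[OF ready lax shape'] rows' by blast
  qed (simp add: x_def)
  have rdy: "ready k u (ws @ l) e"
    unfolding ws e_def by (rule ready_merge[OF ready lax len new hd_pos])
  have len_e: "length e = length d - 1"
    using len by (simp add: e_def length_merge)
  have "zs @ ws @ l = add_rows y e (ws @ l)"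
    unfolding y_def using rows' split(3) lax len len_e by (intro eq_add_rows_strict[OF rdy]) auto
  then have eq: "ys @ l = add_rows y (merge (rotate x d)) (add_rows x d l)"
    by (simp add: split(1) e_def ws)
  \<comment> \<open>From \<open>length f\<close> rows on, the word has made a full turn and the
    count has reached \<open>u\<close>. In the strict phase the contribution of the merge only adds
    to it.\<close>
  have full: "sum_list f \<le> (\<Sum>r<n. f ! (Suc r mod length f))" if "length f \<le> n" for n and f :: "nat list"
    unfolding sum_nth_Suc_mod[symmetric] using that by (intro sum_mono2) auto
  have xlt: "x < length d"
  proof (rule ccontr)
    assume "\<not> x < length d"
    then show False
      using full[of d x] bounds(1) step_count_grown_lax[OF ready lax len new hd_pos, of y x] u
      by (simp add: eq)
  qed
  have ylt: "y < length e"
  proof (rule ccontr)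
    assume "\<not> y < length e"
    then show False
      using full[of e y] bounds(2) step_count_grown_strict[OF ready lax len new hd_pos, of y x] u len_e
      by (simp add: eq e_def)
  qed
  have "0 < d ! x"
  proof (cases ws)
    case Nil
    then show ?thesis
      using hd_pos len by (cases d) (auto simp: x_def)
  next
    case (Cons w ws')
    then obtain n where n: "x = Suc n"
      by (simp add: x_def)
    define l' where "l' = add_rows n d l"
    have rdy': "ready k u l' (rotate n d)"
      unfolding l'_def by (rule ready_add_rows[OF ready])
    have push: "ws @ l = push (hd (rotate n d)) l'"
      by (simp add: ws n l'_def)
    have "tall k u (push (hd (rotate n d)) l')"
      using split(2) Cons push by simp
    moreover have "k + 1 - u = length (rotate n d)"
      using lax by simp
    ultimately have "0 < hd (rotate1 (rotate n d))"
      unfolding tall_push_iff[OF rdy', symmetric] by (simp add: tall_def push_def)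
    then show ?thesis
      using hd_rotate_conv_nth[of d x] xlt by (cases "d = []") (auto simp: n)
  qed
  then show ?thesis
    using eq xlt ylt len_e by (intro exI[of _ x] exI[of _ y]) auto
qed

lemma row_seq_split:
  assumes "sorted_wrt (\<ge>) (row_seq k l)" "\<forall>r\<in>set (row_seq k l). r \<le> Suc u"
  shows "\<exists>ys l'. l = ys @ l' \<and> row_seq k l = replicate (length ys) (Suc u) @ row_seq k l' \<and>
    (\<forall>r\<in>set (row_seq k l'). r \<le> u)"
  using assms
proof (induction l)
  case (Cons x l)
  show ?case
  proof (cases "card (first_row k x l) = Suc u")
    case True
    obtain ys l' where "l = ys @ l'" "row_seq k l = replicate (length ys) (Suc u) @ row_seq k l'"
      "\<forall>r\<in>set (row_seq k l'). r \<le> u"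
      using Cons by auto
    with True show ?thesis
      by (intro exI[of _ "x # ys"] exI[of _ l']) simp
  next
    case False
    with Cons.prems show ?thesis
      by (intro exI[of _ "[]"] exI[of _ "x # l"]) force
  qed
qed simp

lemma step_count_append_other:
  assumes "row_seq k (ys @ l) = replicate (length ys) u @ row_seq k l" "u' < u" "k \<le> u' + v"
  shows "step_count k (ys @ l) u' v = step_count k l u' v"
  using assms(1)
proof (induction ys)
  case (Cons y ys)
  then show ?case
    using step_count_Cons_gt[of u' k y "ys @ l" v] assms(2,3) by simp
qed simp

text \<open>The last cell of the top row has hook length 1. Thus a shape all of whose boundary rows
  have length 0 is empty, the base case of decoding.\<close>

lemma row_seq_pos:
  assumes "is_partition l" "l \<noteq> []" "0 < k"
  shows "\<exists>r\<in>set (row_seq k l). 0 < r"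
  using assms(2,1)
proof (induction l rule: list_nonempty_induct)
  case (single x)
  then have "x - 1 \<in> first_row k x []"
    using assms(3) by (auto simp: first_row_def is_partition_def)
  then have "0 < card (first_row k x [])"
    by (auto simp: card_gt_0_iff)
  then show ?case
    by simp
qed (auto simp: is_partition_def)

lemma ex_valid_code:
  assumes "0 < k"
  shows "k_shape k l \<Longrightarrow> \<forall>r\<in>set (row_seq k l). r \<le> n \<Longrightarrow> n < k \<Longrightarrow>
    (\<And>u. u \<in> {1..n} \<Longrightarrow> step_count k l u (k - u) \<le> u - 1 \<and> step_count k l u (k + 1 - u) \<le> u - 1) \<Longrightarrow>
    \<exists>cs. valid k cs \<and> length cs = n \<and> shape k cs = l"
proof (induction n arbitrary: l)
  case 0
  then have "l = []"
    using row_seq_pos[of l k] assms by (force simp: k_shape_iff)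
  then show ?case
    by simp
next
  case (Suc n)
  obtain ys l' where split: "l = ys @ l'" "row_seq k l = replicate (length ys) (Suc n) @ row_seq k l'"
      "\<forall>r\<in>set (row_seq k l'). r \<le> n"
    using row_seq_split[of k l n] Suc.prems by (auto simp: k_shape_iff)
  have "step_count k l' u (k - u) \<le> u - 1 \<and> step_count k l' u (k + 1 - u) \<le> u - 1" if "u \<in> {1..n}" for u
    using that Suc.prems(4)[of u] step_count_append_other[of k ys l' "Suc n" u] split by simp
  then obtain cs where cs: "valid k cs" "length cs = n" "shape k cs = l'"
    using Suc.IH[of l'] split(3) Suc.prems(1,3) k_shape_append[of k ys l'] by (auto simp: split(1))
  let ?d = "inc (state k cs)"
  have len: "length ?d = k - n"
    using cs by (simp add: length_state)
  have "ready k (Suc n) l' ?d"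
    using shape_invariant[OF cs(1) assms] cs(1,2) Suc.prems(3) len
    unfolding cs(3) by (auto simp: ready_def profile_inc sum_list_inc sum_list_state)
  moreover have "0 < hd ?d"
    using len Suc.prems(3) by (simp add: hd_inc)
  moreover have "Suc n \<notin> set (row_seq k l')"
    using split(3) by force
  moreover have "step_count k (ys @ l') (Suc n) (k + 1 - Suc n) < Suc n"
      "step_count k (ys @ l') (Suc n) (k - Suc n) < Suc n"
    using Suc.prems(4)[of "Suc n"] by (auto simp: split(1))
  ultimately obtain x y where "ys @ l' = add_rows y (merge (rotate x ?d)) (add_rows x ?d l')"
    "x < length ?d" "0 < ?d ! x" "Suc y < length ?d"
    using decode_phase[of k "Suc n" l' ?d ys] len Suc.prems(1,3) split(1,2) by auto
  then show ?case
    using cs by (intro exI[of _ "(x, y) # cs"]) (simp add: split(1))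
qed

section \<open>Irreducible shapes as codes, and their free sites\<close>

lemma finite_columns:
  assumes "is_partition l" "0 < v"
  shows "finite {j. P j \<and> col_ht k l j = v}"
proof (rule finite_subset)
  show "{j. P j \<and> col_ht k l j = v} \<subseteq> {..<width l}"
  proof
    fix j
    assume "j \<in> {j. P j \<and> col_ht k l j = v}"
    then show "j \<in> {..<width l}"
      using full_ht_pos[OF assms(1), of j] col_ht_le_full_ht[of k l j] assms(2) by auto
  qed
qed simp

text \<open>If the bottom row had \<open>k\<close> boundary cells, the hook at the first of them
  would leave no room for cells above. Its \<open>k\<close> columns would have height 1 and violate
  the irreducibility bound at \<open>i = k\<close>.\<close>

lemma irreducible_row_le:
  assumes "l \<in> irreducible_k_shapes k" "r \<in> set (row_seq k l)" "0 < k"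
  shows "r \<le> k - 1"
proof (cases l)
  case (Cons x l')
  let ?F = "first_row k x l'"
  have sorted: "sorted_wrt (\<ge>) (row_seq k l)"
    using assms(1) by (simp add: irreducible_k_shapes_def k_shape_def)
  have "card ?F \<noteq> k"
  proof
    assume card: "card ?F = k"
    have "x - k \<in> ?F"
      using card card_first_row_le[of k x l'] assms(3) mem_first_row_iff[of "x - k" k x l'] by simp
    then have "full_ht l' (x - k) = 0"
      using card card_first_row_le[of k x l'] by (simp add: first_row_def)
    moreover have "x - k \<le> j" if "j \<in> ?F" for j
      using that card mem_first_row_iff[of j k x l'] by auto
    ultimately have zero: "full_ht l' j = 0" if "j \<in> ?F" for j
      using that full_ht_antimono[of "x - k" j l'] by auto
    have "?F \<subseteq> {j. base_len k l j = k \<and> col_ht k l j = 1}"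
    proof
      fix j
      assume "j \<in> ?F"
      then show "j \<in> {j. base_len k l j = k \<and> col_ht k l j = 1}"
        using card zero col_ht_le_full_ht[of k l' j] by (simp add: Cons)
    qed
    moreover have "finite {j. base_len k l j = k \<and> col_ht k l j = 1}"
      using assms(1) by (auto simp: irreducible_k_shapes_def k_shape_def intro: finite_columns)
    ultimately have "k \<le> step_count k l k 1"
      unfolding step_count_def using card card_mono by metis
    moreover have "step_count k l k 1 \<le> k - 1"
      using assms(1,3) by (auto simp: irreducible_k_shapes_def card_h_steps dest!: bspec[of _ _ k])
    ultimately show False
      using assms(3) by linarith
  qed
  then have "card ?F \<le> k - 1"
    using card_first_row_le_k[of k x l'] by linarith
  then show ?thesis
    using sorted assms(2) by (auto simp: Cons)
qed (use assms in simp)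

lemma bij_betw_shape:
  assumes "0 < k"
  shows "bij_betw (shape k) {cs. valid k cs \<and> length cs = k - 1} (irreducible_k_shapes k)"
  unfolding bij_betw_def
proof (intro conjI inj_on_shape equalityI subsetI)
  fix l
  assume l: "l \<in> irreducible_k_shapes k"
  have "step_count k l u (k - u) \<le> u - 1 \<and> step_count k l u (k + 1 - u) \<le> u - 1" if "u \<in> {1..k - 1}" for u
  proof -
    have "u \<in> {1..k}" "u \<noteq> 0"
      using that by auto
    with l show ?thesis
      unfolding irreducible_k_shapes_def by (auto simp: card_h_steps)
  qed
  then obtain cs where "valid k cs" "length cs = k - 1" "shape k cs = l"
    using ex_valid_code[OF assms, of l "k - 1"] l irreducible_row_le[OF l _ assms] assms
    by (auto simp: irreducible_k_shapes_def)
  then show "l \<in> shape k ` {cs. valid k cs \<and> length cs = k - 1}"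
    by blast
qed (use valid_shape_irreducible assms in auto)

text \<open>A free site refers to all cells, not only to horizontal steps. Below a cell in a row of
  length \<open>k - i\<close> the base row of its column is at least as long, and
  \<open>base_len_plus_col_ht_le\<close> at height \<open>i + 1\<close> allows no more than
  \<open>k - i\<close>.\<close>

lemma free_site_iff:
  assumes "k_shape k l" "i < k"
  shows "free_site k l i \<longleftrightarrow> step_count k l (k - i) (i + 1) = 0"
proof -
  have fin: "finite {j. base_len k l j = k - i \<and> col_ht k l j = i + 1}"
    using assms(1) by (auto simp: k_shape_def intro: finite_columns)
  have "\<exists>j. base_len k l j = k - i \<and> col_ht k l j = i + 1"
    if cell: "(r, j) \<in> k_boundary k l" and row: "row_len k l r = k - i" and col: "col_ht k l j = i + 1" for r j
  proof -
    obtain r' where r': "(r', j) \<in> k_boundary k l" "\<forall>r''<r'. (r'', j) \<notin> k_boundary k l"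
      using exists_least_iff[of "\<lambda>r. (r, j) \<in> k_boundary k l"] cell by blast
    then have step: "(r', j) \<in> h_steps k l"
      by (simp add: h_steps_def)
    have "r' \<le> r" "r < length l"
      using r' cell by (auto simp: not_less[symmetric] k_boundary_def diagram_def)
    moreover have "\<forall>r r'. r' < r \<longrightarrow> r < length l \<longrightarrow> row_len k l r \<le> row_len k l r'"
      using assms(1) by (auto simp: k_shape_def row_seq_def sorted_wrt_iff_nth_less)
    ultimately have ge: "k - i \<le> row_len k l r'"
      using row by (metis le_neq_implies_less order_refl)
    then have "base_len k l j = row_len k l r'"
      using step assms(2) by (subst base_len_eq_iff) auto
    with ge col base_len_plus_col_ht_le[of k l j] show ?thesis
      by (intro exI[of _ j]) linarith
  qed
  moreover have "\<exists>r. (r, j) \<in> k_boundary k l \<and> row_len k l r = k - i" if "base_len k l j = k - i" for j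
    using that base_len_eq_iff[of "k - i" k l j] assms(2) by (auto simp: h_steps_def)
  ultimately have "H_cells k l (k - i) \<inter> V_cells k l (i + 1) = {} \<longleftrightarrow>
      {j. base_len k l j = k - i \<and> col_ht k l j = i + 1} = {}"
    unfolding H_cells_def V_cells_def by blast
  then show ?thesis
    using fin by (simp add: free_site_def step_count_def)
qed

lemma free_site_shape:
  assumes "valid k cs" "length cs = k - 1" "1 \<le> i" "i < k - 1"
  shows "free_site k (shape k cs) i \<longleftrightarrow> fst (cs ! (i - 1)) = 0"
proof -
  have "k_shape k (shape k cs)"
    using valid_shape_irreducible[OF assms(1,2)] assms(4) by (simp add: irreducible_k_shapes_def)
  moreover have "length cs - (i - 1) = k - i" "k + 1 - (k - i) = i + 1" "i - 1 < length cs"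
    using assms by auto
  ultimately show ?thesis
    using step_count_shape_eq_0_iff[OF assms(1), of "i - 1"] free_site_iff[of k _ i] assms(4) by simp
qed

section \<open>The adjoint recursions\<close>

text \<open>Undoing one phase with \<open>m\<close> occupied cells: \<open>m\<close> choices of
  \<open>y\<close>; two summands for the cell absorbed by the merge, empty or occupied; the number
  of \<open>x\<close> compatible with the flag; and two values of \<open>v\<close> for the cell of
  the new column, occupied before or not.\<close>

definition transfer :: "bool \<Rightarrow> (nat \<Rightarrow> nat) \<Rightarrow> nat \<Rightarrow> nat" where
  "transfer t v m =
     m * ((if t then 1 else m - 1) * (v m + v (m - 1)) + (if t then 1 else m) * (v (m + 1) + v m))"

fun code_count :: "bool list \<Rightarrow> nat \<Rightarrow> nat" where
  "code_count [] m = (if m = 0 then 1 else 0)"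
| "code_count (t # ts) m = transfer t (code_count ts) m"

text \<open>\<open>q\<close> is the number of values above the current even number. The odd position
  has \<open>q + 1\<close> choices; the even one is fixed or has \<open>q\<close>, and in the latter
  case the maps that avoid the current value are subtracted.\<close>

definition pistol_step :: "(nat \<Rightarrow> int) \<Rightarrow> bool \<Rightarrow> nat \<Rightarrow> int" where
  "pistol_step w t q =
     (if t then (int q + 1) * w (q + 1) else int q * ((int q + 1) * w (q + 1) - int q * w q))"

definition diff :: "(nat \<Rightarrow> int) \<Rightarrow> nat \<Rightarrow> int" where
  "diff w q = w (Suc q) - w q"

definition diff_at_1 :: "nat \<Rightarrow> (nat \<Rightarrow> int) \<Rightarrow> int" where
  "diff_at_1 n w = (diff ^^ n) w 1"

lemma diff_iterate_add: "(diff ^^ n) (\<lambda>q. f q + g q) q = (diff ^^ n) f q + (diff ^^ n) g q"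
  by (induction n arbitrary: q) (auto simp: diff_def)

text \<open>The discrete Leibniz rule, with two terms because the second difference of
  \<open>q\<close> vanishes. The factor \<open>n\<close> makes the truncated \<open>n - 1\<close>
  harmless at \<open>n = 0\<close>.\<close>

lemma diff_iterate_mult:
  "(diff ^^ n) (\<lambda>q. int q * w q) q = (int q + int n) * (diff ^^ n) w q + int n * (diff ^^ (n - 1)) w q"
proof (induction n arbitrary: q)
  case (Suc n)
  have step: "int n * (diff ^^ n) w q = int n * (diff ^^ (n - 1)) w (Suc q) - int n * (diff ^^ (n - 1)) w q"
    by (cases n) (auto simp: diff_def algebra_simps)
  show ?case
    using step by (simp add: diff_def[of "(diff ^^ n) _"] Suc.IH algebra_simps)
qed simp

lemma diff_at_1_mult:
  "diff_at_1 n (\<lambda>q. int q * w q) = (int n + 1) * diff_at_1 n w + int n * diff_at_1 (n - 1) w"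
  by (simp add: diff_at_1_def diff_iterate_mult algebra_simps)

lemma diff_at_1_diff: "diff_at_1 n (diff w) = diff_at_1 (Suc n) w"
  by (simp add: diff_at_1_def funpow_swap1)

text \<open>With \<open>g q = q * w q\<close>, the step is \<open>g + diff g\<close> for a fixed
  point and \<open>q * diff g\<close> otherwise. Both give three-term formulas, whose coefficients
  are those of \<open>transfer\<close> transposed.\<close>

lemma diff_at_1_pistol_step_True:
  "diff_at_1 n (pistol_step w True) =
     (int n + 2) * diff_at_1 (n + 1) w + 2 * (int n + 1) * diff_at_1 n w + int n * diff_at_1 (n - 1) w"
proof -
  let ?g = "\<lambda>q. int q * w q"
  have "pistol_step w True = (\<lambda>q. ?g q + diff ?g q)"
    by (auto simp: pistol_step_def diff_def algebra_simps)
  then have "diff_at_1 n (pistol_step w True) = diff_at_1 n ?g + diff_at_1 (Suc n) ?g"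
    by (simp add: diff_at_1_def diff_iterate_add funpow_swap1)
  then show ?thesis
    by (simp add: diff_at_1_mult algebra_simps)
qed

lemma diff_at_1_pistol_step_False:
  "diff_at_1 n (pistol_step w False) =
     (int n + 1) * (int n + 2) * diff_at_1 (n + 1) w + (int n + 1) * (2 * int n + 1) * diff_at_1 n w
     + (int n)\<^sup>2 * diff_at_1 (n - 1) w"
proof -
  let ?g = "\<lambda>q. int q * w q"
  have "pistol_step w False = (\<lambda>q. int q * diff ?g q)"
    by (auto simp: pistol_step_def diff_def algebra_simps)
  then have "diff_at_1 n (pistol_step w False) =
      (int n + 1) * diff_at_1 (Suc n) ?g + int n * diff_at_1 (Suc (n - 1)) ?g"
    by (simp only: diff_at_1_mult diff_at_1_diff)
  also have "int n * diff_at_1 (Suc (n - 1)) ?g = int n * diff_at_1 n ?g"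
    by (cases n) auto
  finally show ?thesis
    by (simp add: diff_at_1_mult algebra_simps power2_eq_square)
qed

text \<open>\<open>diff_at_1 n w\<close> is the coefficient of the binomial \<open>q - 1\<close>
  over \<open>n\<close> in the Newton expansion of \<open>w\<close>; the unit vector at
  \<open>m = n + 1\<close> reads it off.\<close>

definition pairing :: "nat \<Rightarrow> (nat \<Rightarrow> nat) \<Rightarrow> (nat \<Rightarrow> int) \<Rightarrow> int" where
  "pairing N f w = (\<Sum>n<N. int (f (Suc n)) * diff_at_1 n w)"

text \<open>The two operators are adjoint, up to a boundary term that vanishes beyond the support
  of \<open>f\<close>.\<close>

lemma pairing_transfer_boundary:
  assumes "f 0 = 0"
  shows "pairing N (transfer t f) w = pairing N f (pistol_step w t) +
    (if t then int N * int (f (Suc N)) * diff_at_1 (N - 1) w - (int N + 1) * int (f N) * diff_at_1 N w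
     else (int N)\<^sup>2 * int (f (Suc N)) * diff_at_1 (N - 1) w
       - int N * (int N + 1) * int (f N) * diff_at_1 N w)"
proof (induction N)
  case 0
  then show ?case
    by (simp add: pairing_def assms)
next
  case (Suc N)
  have "pairing (Suc N) g w' = pairing N g w' + int (g (Suc N)) * diff_at_1 N w'" for g w'
    by (simp add: pairing_def)
  with Suc show ?case
    by (cases t) (simp_all add: transfer_def diff_at_1_pistol_step_True diff_at_1_pistol_step_False
        algebra_simps power2_eq_square)
qed

lemma pairing_transfer:
  "f 0 = 0 \<Longrightarrow> f N = 0 \<Longrightarrow> f (Suc N) = 0 \<Longrightarrow>
     pairing N (transfer t f) w = pairing N f (pistol_step w t)"
  using pairing_transfer_boundary[of f N t w] by simp

lemma code_count_eq_0: "length ts < m \<Longrightarrow> code_count ts m = 0"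
  by (induction ts arbitrary: m) (auto simp: transfer_def)

text \<open>Each flag moves from the outside of the code operator to \<open>w\<close>, which turns
  the recursion into a \<open>foldl\<close>. What remains, \<open>code_count [True]\<close>, is the
  unit vector at 1 and evaluates at 1. The bound on \<open>N\<close> makes the boundary terms
  vanish.\<close>

lemma pairing_code_count:
  assumes "length ts + 2 \<le> N"
  shows "pairing N (code_count (ts @ [True])) w = foldl pistol_step w ts 1"
  using assms
proof (induction ts arbitrary: w)
  case Nil
  have "int (code_count [True] (Suc n)) * diff_at_1 n w = (if n = 0 then w 1 else 0)" for n
    by (cases n) (auto simp: transfer_def diff_at_1_def)
  then show ?case
    using Nil by (simp add: pairing_def)
next
  case (Cons t ts)
  have "code_count (ts @ [True]) 0 = 0"
    by (cases ts) (auto simp: transfer_def)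
  moreover have "code_count (ts @ [True]) N = 0" "code_count (ts @ [True]) (Suc N) = 0"
    using Cons.prems by (auto intro!: code_count_eq_0)
  moreover have "code_count ((t # ts) @ [True]) = transfer t (code_count (ts @ [True]))"
    by auto
  ultimately have "pairing N (code_count ((t # ts) @ [True])) w =
      pairing N (code_count (ts @ [True])) (pistol_step w t)"
    by (simp only: pairing_transfer)
  also have "\<dots> = foldl pistol_step w (t # ts) 1"
    using Cons by simp
  finally show ?case .
qed

text \<open>The constant function 1 has only its zeroth difference, so pairing with it extracts the
  value at \<open>m = 1\<close>.\<close>

lemma code_count_eq_foldl:
  "int (code_count (ts @ [True]) 1) = foldl pistol_step (\<lambda>_. 1) ts 1"
proof -
  have const: "(diff ^^ Suc n) (\<lambda>_. 1) = (\<lambda>_. 0)" for n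
    by (induction n) (auto simp: diff_def)
  have "int (code_count (ts @ [True]) (Suc n)) * diff_at_1 n (\<lambda>_. 1) =
      (if n = 0 then int (code_count (ts @ [True]) 1) else 0)" for n
    using const[of "n - 1"] by (cases n) (auto simp: diff_at_1_def)
  then have "pairing (length ts + 2) (code_count (ts @ [True])) (\<lambda>_. 1) =
      int (code_count (ts @ [True]) 1)"
    by (simp add: pairing_def)
  then show ?thesis
    using pairing_code_count[of ts "length ts + 2"] by simp
qed

text \<open>Only the values up to \<open>2 * j\<close> have to be attained. The free set \<open>E\<close> of further values
  makes a recursion on \<open>j\<close> possible: the maps attaining \<open>2 * j + 2\<close> are all maps minus those
  that avoid it.\<close>

definition pistols :: "nat \<Rightarrow> nat set \<Rightarrow> (nat \<Rightarrow> bool) \<Rightarrow> (nat \<Rightarrow> nat) set" where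
  "pistols j E t = {f \<in> {1..2*j} \<rightarrow>\<^sub>E (\<lambda>i. 2*i) ` {1..j} \<union> E.
     (\<forall>x\<in>{1..2*j}. x \<le> f x) \<and> (\<lambda>i. 2*i) ` {1..j} \<subseteq> f ` {1..2*j} \<and>
     (\<forall>i\<in>{1..j}. f (2*i) = 2*i \<longleftrightarrow> t i)}"

definition extend :: "nat \<Rightarrow> (nat \<Rightarrow> nat) \<times> nat \<times> nat \<Rightarrow> nat \<Rightarrow> nat" where
  "extend j = (\<lambda>(f, a, b). f(2*j+1 := a, 2*j+2 := b))"

lemma inj_on_extend:
  "inj_on (extend j) (({1..2*j} \<rightarrow>\<^sub>E A) \<times> UNIV)"
proof (rule inj_onI)
  fix p p'
  assume p: "p \<in> ({1..2*j} \<rightarrow>\<^sub>E A) \<times> UNIV" "p' \<in> ({1..2*j} \<rightarrow>\<^sub>E A) \<times> UNIV" "extend j p = extend j p'"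
  obtain f a b f' a' b' where pp: "p = (f, a, b)" "p' = (f', a', b')"
    by (cases p, cases p')
  have f: "f \<in> {1..2*j} \<rightarrow>\<^sub>E A" "f' \<in> {1..2*j} \<rightarrow>\<^sub>E A"
    and eq: "extend j (f, a, b) = extend j (f', a', b')"
    using p by (auto simp: pp)
  have "f x = f' x" for x
  proof (cases "x \<in> {1..2*j}")
    case True
    then show ?thesis
      using fun_cong[OF eq, of x] by (auto simp: extend_def)
  next
    case False
    then show ?thesis
      using PiE_arb[OF f(1) False] PiE_arb[OF f(2) False] by simp
  qed
  moreover have "a = a'" "b = b'"
    using fun_cong[OF eq, of "2*j+1"] fun_cong[OF eq, of "2*j+2"] by (auto simp: extend_def)
  ultimately show "p = p'"
    by (auto simp: pp)
qed

lemma finite_pistols: "finite E \<Longrightarrow> finite (pistols j E t)"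
  by (rule finite_subset[of _ "{1..2*j} \<rightarrow>\<^sub>E (\<lambda>i. 2*i) ` {1..j} \<union> E"])
    (auto simp: pistols_def intro!: finite_PiE)

text \<open>The two new positions exceed all even numbers up to \<open>2*j\<close>, so they cannot
  help to attain these, and for the old positions \<open>2*j+2\<close> is just one more free value.
  Only attaining \<open>2*j+2\<close> itself links old and new.\<close>

lemma extend_mem_pistols:
  assumes E: "\<forall>e\<in>E. 2 * Suc j < e" and g: "g \<in> extensional {1..2*j}"
  shows "extend j (g, a, b) \<in> pistols (Suc j) E t \<longleftrightarrow>
    g \<in> pistols j (insert (2*j+2) E) t \<and> a \<in> insert (2*j+2) E \<and>
    b \<in> (if t (Suc j) then {2*j+2} else E) \<and> 2*j+2 \<in> g ` {1..2*j} \<union> {a, b}"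
proof -
  let ?F = "extend j (g, a, b)" and ?S = "(\<lambda>i. 2*i) ` {1..j} \<union> insert (2*j+2) E"
  have dom: "{1..2 * Suc j} = insert (2*j+1) (insert (2*j+2) {1..2*j})"
    by auto
  have cod: "(\<lambda>i. 2*i) ` {1..Suc j} = insert (2*j+2) ((\<lambda>i. 2*i) ` {1..j})"
    by (auto simp: atLeastAtMostSuc_conv)
  have F: "?F x = g x" if "x \<in> {1..2*j}" for x
    using that by (auto simp: extend_def)
  have Fab: "?F (2*j+1) = a" "?F (2*j+2) = b"
    by (simp_all add: extend_def)
  have "?F ` {1..2*j} = g ` {1..2*j}"
    using F by (intro image_cong) auto
  then have img: "?F ` {1..2 * Suc j} = g ` {1..2*j} \<union> {a, b}"
    unfolding dom image_insert Fab by auto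
  have ext: "?F \<in> extensional {1..2 * Suc j}"
    using g by (auto simp: extensional_def extend_def)
  have PiE: "?F \<in> {1..2 * Suc j} \<rightarrow>\<^sub>E (\<lambda>i. 2*i) ` {1..Suc j} \<union> E \<longleftrightarrow>
      g \<in> {1..2*j} \<rightarrow>\<^sub>E ?S \<and> a \<in> ?S \<and> b \<in> ?S"
  proof -
    have "?F \<in> {1..2 * Suc j} \<rightarrow>\<^sub>E (\<lambda>i. 2*i) ` {1..Suc j} \<union> E \<longleftrightarrow> ?F ` {1..2 * Suc j} \<subseteq> ?S"
      using ext unfolding cod by (auto simp: PiE_iff)
    also have "\<dots> \<longleftrightarrow> g ` {1..2*j} \<subseteq> ?S \<and> a \<in> ?S \<and> b \<in> ?S"
      unfolding img by auto
    finally show ?thesis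
      using g by (auto simp: PiE_iff)
  qed
  have ge: "(\<forall>x\<in>{1..2 * Suc j}. x \<le> ?F x) \<longleftrightarrow> (\<forall>x\<in>{1..2*j}. x \<le> g x) \<and> 2*j+1 \<le> a \<and> 2*j+2 \<le> b"
  proof -
    have "(\<forall>x\<in>{1..2*j}. x \<le> ?F x) \<longleftrightarrow> (\<forall>x\<in>{1..2*j}. x \<le> g x)"
      by (intro ball_cong refl) (simp only: F)
    then show ?thesis
      unfolding dom ball_simps(7) Fab by argo
  qed
  have fixes': "(\<forall>i\<in>{1..Suc j}. ?F (2*i) = 2*i \<longleftrightarrow> t i) \<longleftrightarrow>
      (\<forall>i\<in>{1..j}. g (2*i) = 2*i \<longleftrightarrow> t i) \<and> (b = 2*j+2 \<longleftrightarrow> t (Suc j))"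
  proof -
    have "(\<forall>i\<in>{1..j}. ?F (2*i) = 2*i \<longleftrightarrow> t i) \<longleftrightarrow> (\<forall>i\<in>{1..j}. g (2*i) = 2*i \<longleftrightarrow> t i)"
      by (intro ball_cong refl) (simp add: F)
    moreover have "{1..Suc j} = insert (Suc j) {1..j}" "2 * Suc j = 2*j+2"
      by auto
    ultimately show ?thesis
      unfolding ball_simps(7) Fab by (simp only: ball_simps(7) Fab conj_commute)
  qed
  have a: "a \<in> ?S \<and> 2*j+1 \<le> a \<longleftrightarrow> a \<in> insert (2*j+2) E"
    using E by auto
  have b: "b \<in> ?S \<and> 2*j+2 \<le> b \<and> (b = 2*j+2 \<longleftrightarrow> t (Suc j)) \<longleftrightarrow>
      b \<in> (if t (Suc j) then {2*j+2} else E)"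
    using E by auto
  have hit: "(\<lambda>i. 2*i) ` {1..j} \<subseteq> g ` {1..2*j} \<union> {a, b} \<longleftrightarrow> (\<lambda>i. 2*i) ` {1..j} \<subseteq> g ` {1..2*j}"
    if "2*j+1 \<le> a" "2*j+2 \<le> b"
  proof -
    have "a \<notin> (\<lambda>i. 2*i) ` {1..j}" "b \<notin> (\<lambda>i. 2*i) ` {1..j}"
      using that by auto
    then show ?thesis
      by blast
  qed
  have "?F \<in> pistols (Suc j) E t \<longleftrightarrow> g \<in> {1..2*j} \<rightarrow>\<^sub>E ?S \<and> (\<forall>x\<in>{1..2*j}. x \<le> g x) \<and>
      (\<forall>i\<in>{1..j}. g (2*i) = 2*i \<longleftrightarrow> t i) \<and>
      (a \<in> ?S \<and> 2*j+1 \<le> a) \<and> (b \<in> ?S \<and> 2*j+2 \<le> b \<and> (b = 2*j+2 \<longleftrightarrow> t (Suc j))) \<and>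
      (\<lambda>i. 2*i) ` {1..j} \<subseteq> g ` {1..2*j} \<union> {a, b} \<and> 2*j+2 \<in> g ` {1..2*j} \<union> {a, b}"
    unfolding pistols_def mem_Collect_eq PiE ge img fixes' unfolding cod insert_subset
    by (rule iffI; elim conjE; intro conjI; assumption)
  also have "\<dots> \<longleftrightarrow> g \<in> {1..2*j} \<rightarrow>\<^sub>E ?S \<and> (\<forall>x\<in>{1..2*j}. x \<le> g x) \<and>
      (\<forall>i\<in>{1..j}. g (2*i) = 2*i \<longleftrightarrow> t i) \<and>
      (a \<in> ?S \<and> 2*j+1 \<le> a) \<and> (b \<in> ?S \<and> 2*j+2 \<le> b \<and> (b = 2*j+2 \<longleftrightarrow> t (Suc j))) \<and>
      (\<lambda>i. 2*i) ` {1..j} \<subseteq> g ` {1..2*j} \<and> 2*j+2 \<in> g ` {1..2*j} \<union> {a, b}"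
    by (rule iffI; elim conjE; intro conjI; (assumption | simp only: hit))
  also have "\<dots> \<longleftrightarrow> g \<in> pistols j (insert (2*j+2) E) t \<and> a \<in> insert (2*j+2) E \<and>
    b \<in> (if t (Suc j) then {2*j+2} else E) \<and> 2*j+2 \<in> g ` {1..2*j} \<union> {a, b}"
    unfolding a b unfolding pistols_def mem_Collect_eq
    by (rule iffI; elim conjE; intro conjI; assumption)
  finally show ?thesis .
qed

lemma pistols_avoid:
  assumes "e \<notin> E" "e \<notin> (\<lambda>i. 2*i) ` {1..j}"
  shows "g \<in> pistols j E t \<longleftrightarrow> g \<in> pistols j (insert e E) t \<and> e \<notin> g ` {1..2*j}"
proof -
  have "g \<in> {1..2*j} \<rightarrow>\<^sub>E (\<lambda>i. 2*i) ` {1..j} \<union> E \<longleftrightarrow>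
      g \<in> {1..2*j} \<rightarrow>\<^sub>E (\<lambda>i. 2*i) ` {1..j} \<union> insert e E \<and> e \<notin> g ` {1..2*j}"
    using assms unfolding PiE_iff by blast
  then show ?thesis
    unfolding pistols_def mem_Collect_eq by blast
qed

text \<open>If \<open>2*j+2\<close> is a fixed point it is attained automatically, so nothing is
  subtracted.\<close>

lemma pistols_Suc:
  assumes E: "\<forall>e\<in>E. 2 * Suc j < e"
  shows "pistols (Suc j) E t =
    extend j ` (pistols j (insert (2*j+2) E) t \<times>
      (insert (2*j+2) E \<times> (if t (Suc j) then {2*j+2} else E)))
    - extend j ` (pistols j E t \<times> (E \<times> (if t (Suc j) then {} else E)))" (is "?P = ?A - ?B")
proof (rule set_eqI)
  fix f :: "nat \<Rightarrow> nat"
  let ?g = "restrict f {1..2*j}" and ?a = "f (2*j+1)" and ?b = "f (2*j+2)"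
  define D where "D = ({1..2*j} \<rightarrow>\<^sub>E ((\<lambda>i. 2*i) ` {1..j} \<union> insert (2*j+2) E)) \<times> (UNIV :: (nat \<times> nat) set)"
  have inj: "inj_on (extend j) D"
    unfolding D_def by (rule inj_on_extend)
  have sub: "pistols j (insert (2*j+2) E) t \<times> X \<subseteq> D" "pistols j E t \<times> X \<subseteq> D" for X
  proof -
    have "pistols j E' t \<subseteq> {1..2*j} \<rightarrow>\<^sub>E (\<lambda>i. 2*i) ` {1..j} \<union> E'" for E'
      unfolding pistols_def by (rule Collect_subset)
    moreover have "({1..2*j} \<rightarrow>\<^sub>E (\<lambda>i. 2*i) ` {1..j} \<union> E) \<subseteq>
        ({1..2*j} \<rightarrow>\<^sub>E (\<lambda>i. 2*i) ` {1..j} \<union> insert (2*j+2) E)"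
      by (intro PiE_mono) auto
    ultimately show "pistols j (insert (2*j+2) E) t \<times> X \<subseteq> D" "pistols j E t \<times> X \<subseteq> D"
      unfolding D_def by (meson Sigma_mono order_trans subset_UNIV)+
  qed
  have avoid: "g \<in> pistols j E t \<longleftrightarrow> g \<in> pistols j (insert (2*j+2) E) t \<and> 2*j+2 \<notin> g ` {1..2*j}" for g
    using E by (intro pistols_avoid) auto
  have E': "2*j+2 \<notin> E"
    using E by auto
  show "f \<in> ?P \<longleftrightarrow> f \<in> ?A - ?B"
  proof
    assume f: "f \<in> ?P"
    then have "f \<in> extensional {1..2 * Suc j}"
      by (simp add: pistols_def PiE_iff)
    then have "f = extend j (?g, ?a, ?b)"
      by (auto simp: extend_def extensional_def fun_eq_iff)
    with f obtain g a b where f': "f = extend j (g, a, b)" "g \<in> extensional {1..2*j}" "f \<in> ?P"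
      by (metis restrict_extensional)
    have mem: "g \<in> pistols j (insert (2*j+2) E) t" "a \<in> insert (2*j+2) E"
        "b \<in> (if t (Suc j) then {2*j+2} else E)" "2*j+2 \<in> g ` {1..2*j} \<union> {a, b}"
      using f'(3) unfolding f'(1) extend_mem_pistols[OF E f'(2)] by auto
    then have "f \<in> ?A"
      unfolding f'(1) by blast
    moreover have "f \<notin> ?B"
    proof
      assume "f \<in> ?B"
      then obtain p where p: "p \<in> pistols j E t \<times> (E \<times> (if t (Suc j) then {} else E))"
        "extend j (g, a, b) = extend j p"
        unfolding f'(1) by blast
      have "(g, a, b) = p"
      proof (rule inj_onD[OF inj p(2)])
        show "(g, a, b) \<in> D"
          using mem(1) sub(1)[of UNIV] by blast
        show "p \<in> D"
          using p(1) sub(2) by blast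
      qed
      then show False
        using p(1) mem(4) avoid[of g] E' by (auto split: if_splits)
    qed
    ultimately show "f \<in> ?A - ?B"
      by blast
  next
    assume f: "f \<in> ?A - ?B"
    then obtain g a b where f': "f = extend j (g, a, b)" "g \<in> pistols j (insert (2*j+2) E) t"
      "a \<in> insert (2*j+2) E" "b \<in> (if t (Suc j) then {2*j+2} else E)"
      by blast
    have "g \<in> extensional {1..2*j}"
      using f'(2) by (simp add: pistols_def PiE_iff)
    moreover have "2*j+2 \<in> g ` {1..2*j} \<union> {a, b}"
    proof (rule ccontr)
      assume "2*j+2 \<notin> g ` {1..2*j} \<union> {a, b}"
      then have "(g, a, b) \<in> pistols j E t \<times> (E \<times> (if t (Suc j) then {} else E))"
        using f' avoid[of g] by (auto split: if_splits)
      then show False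
        using f f'(1) by blast
    qed
    ultimately show "f \<in> ?P"
      using f' extend_mem_pistols[OF E] by blast
  qed
qed

lemma card_pistols_Suc:
  assumes E: "\<forall>e\<in>E. 2 * Suc j < e" and fin: "finite E"
  shows "int (card (pistols (Suc j) E t)) =
    (int (card E) + 1) * (if t (Suc j) then 1 else int (card E)) * int (card (pistols j (insert (2*j+2) E) t))
    - (if t (Suc j) then 0 else (int (card E))\<^sup>2 * int (card (pistols j E t)))"
proof -
  let ?X = "pistols j (insert (2*j+2) E) t \<times> (insert (2*j+2) E \<times> (if t (Suc j) then {2*j+2} else E))"
  let ?Y = "pistols j E t \<times> (E \<times> (if t (Suc j) then {} else E))"
  have E': "2*j+2 \<notin> E"
    using E by auto
  have "2*j+2 \<notin> (\<lambda>i. 2*i) ` {1..j}"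
    by auto
  then have "pistols j E t \<subseteq> pistols j (insert (2*j+2) E) t"
    using pistols_avoid[OF E', of j _ t] by blast
  then have sub: "?Y \<subseteq> ?X"
    by auto
  have inj: "inj_on (extend j) ?X"
    by (rule inj_on_subset[OF inj_on_extend[of j "(\<lambda>i. 2*i) ` {1..j} \<union> insert (2*j+2) E"]])
      (auto simp: pistols_def)
  have finX: "finite ?X"
    using fin by (auto intro: finite_pistols)
  have "card (pistols (Suc j) E t) = card (extend j ` ?X) - card (extend j ` ?Y)"
    unfolding pistols_Suc[OF E]
    by (intro card_Diff_subset finite_imageI image_mono sub finite_subset[OF sub finX])
  moreover have "card (extend j ` ?Y) \<le> card (extend j ` ?X)"
    by (intro card_mono finite_imageI image_mono sub finX)
  moreover have "card (extend j ` ?X) = card ?X" "card (extend j ` ?Y) = card ?Y"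
    using inj inj_on_subset[OF inj sub] by (auto intro: card_image)
  ultimately have "int (card (pistols (Suc j) E t)) = int (card ?X) - int (card ?Y)"
    by simp
  then show ?thesis
    using fin E' by (cases "t (Suc j)") (simp_all add: card_cartesian_product power2_eq_square algebra_simps)
qed

lemma card_pistols:
  assumes "finite E" "\<forall>e\<in>E. 2 * j < e"
  shows "int (card (pistols j E t)) = foldl pistol_step (\<lambda>_. 1) (map t [1..<Suc j]) (card E)"
  using assms
proof (induction j arbitrary: E)
  case 0
  have "pistols 0 E t = {\<lambda>_. undefined}"
    by (auto simp: pistols_def)
  then show ?case
    by simp
next
  case (Suc j)
  define w where "w = foldl pistol_step (\<lambda>_. 1) (map t [1..<Suc j])"
  have IH: "int (card (pistols j E' t)) = w (card E')" if "finite E'" "\<forall>e\<in>E'. 2 * j < e" for E'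
    using Suc.IH that by (simp add: w_def)
  have "2*j+2 \<notin> E"
    using Suc.prems by auto
  then have "int (card (pistols j (insert (2*j+2) E) t)) = w (card E + 1)"
    using Suc.prems by (subst IH) auto
  moreover have "int (card (pistols j E t)) = w (card E)"
    using Suc.prems by (intro IH) auto
  ultimately have "int (card (pistols (Suc j) E t)) = pistol_step w (t (Suc j)) (card E)"
    unfolding pistol_step_def card_pistols_Suc[OF Suc.prems(2,1), of t]
    by (cases "t (Suc j)") (simp_all add: algebra_simps power2_eq_square)
  also have "pistol_step w (t (Suc j)) = foldl pistol_step (\<lambda>_. 1) (map t [1..<Suc (Suc j)])"
    by (simp add: w_def)
  finally show ?case .
qed

lemma card_surj_pistols:
  "int (card {f \<in> surj_pistols (Suc j). \<forall>i\<in>{1..j}. f (2*i) = 2*i \<longleftrightarrow> t i}) =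
     foldl pistol_step (\<lambda>_. 1) (map t [1..<Suc j]) 1"
proof -
  \<comment> \<open>The last even position is always a fixed point, since it is the largest value.
    Recording this as a flag, with no further values, gives
    \<open>pistol_step w True 0 = w 1\<close>: hence the evaluation at 1.\<close>
  define t' where "t' = t(Suc j := True)"
  have last: "f (2 * Suc j) = 2 * Suc j" if "f \<in> surj_pistols (Suc j)" for f
  proof -
    have "f (2 * Suc j) \<in> (\<lambda>i. 2*i) ` {1..Suc j}" "2 * Suc j \<le> f (2 * Suc j)"
      using that unfolding surj_pistols_def by (auto simp: PiE_iff)
    then show ?thesis
      by auto
  qed
  have "{f \<in> surj_pistols (Suc j). \<forall>i\<in>{1..j}. f (2*i) = 2*i \<longleftrightarrow> t i} =
      {f \<in> surj_pistols (Suc j). \<forall>i\<in>{1..Suc j}. f (2*i) = 2*i \<longleftrightarrow> t' i}"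
    using last by (auto simp: t'_def atLeastAtMostSuc_conv)
  also have "\<dots> = pistols (Suc j) {} t'"
    unfolding surj_pistols_def pistols_def by (auto simp: PiE_iff)
  finally have "int (card {f \<in> surj_pistols (Suc j). \<forall>i\<in>{1..j}. f (2*i) = 2*i \<longleftrightarrow> t i}) =
      foldl pistol_step (\<lambda>_. 1) (map t' [1..<Suc (Suc j)]) 0"
    using card_pistols[of "{}" "Suc j" t'] by simp
  moreover have "map t' [1..<Suc (Suc j)] = map t [1..<Suc j] @ [True]"
    by (auto simp: t'_def)
  then have "foldl pistol_step (\<lambda>_. 1) (map t' [1..<Suc (Suc j)]) 0 =
      foldl pistol_step (\<lambda>_. 1) (map t [1..<Suc j]) 1"
    by (simp only: foldl_append foldl.simps pistol_step_def) simp
  ultimately show ?thesis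
    by simp
qed

section \<open>Counting codes\<close>

definition ones :: "bool list \<Rightarrow> nat" where
  "ones b = length (filter id b)"

definition unrotate :: "nat \<Rightarrow> 'a list \<Rightarrow> 'a list" where
  "unrotate n l = rotate (length l - n) l"

lemma ones_simps [simp]: "ones [] = 0" "ones (c # b) = of_bool c + ones b"
  by (simp_all add: ones_def)

lemma ones_eq_0_iff: "ones b = 0 \<longleftrightarrow> b = replicate (length b) False"
  by (induction b) auto

lemma length_unrotate [simp]: "length (unrotate n l) = length l"
  by (simp add: unrotate_def)

lemma rotate_eq_iff: "n \<le> length l \<Longrightarrow> rotate n f = l \<longleftrightarrow> f = unrotate n l"
  by (auto simp: unrotate_def rotate_rotate)

lemma rotate_unrotate: "n \<le> length l \<Longrightarrow> rotate n (unrotate n l) = l"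
  by (simp add: rotate_eq_iff)

lemma ones_rotate [simp]: "ones (rotate n b) = ones b"
proof (induction n)
  case (Suc n)
  have "ones (rotate1 c) = ones c" for c
    by (cases c) (auto simp: ones_def)
  with Suc show ?case
    by simp
qed simp

lemma ones_unrotate [simp]: "ones (unrotate n b) = ones b"
  by (simp add: unrotate_def)

text \<open>Each cell is brought to the head by exactly one amount below \<open>length e\<close>, so
  the positions of the occupied cells do not affect the count.\<close>

lemma card_hd_unrotate: "card {x. x < length e \<and> hd (unrotate x e)} = ones e"
proof (cases "e = []")
  case False
  let ?p = "length e"
  define g where "g x = (?p - x) mod ?p" for x
  have g: "g x < ?p" "g (g x) = x" if "x < ?p" for x
    using that by (auto simp: g_def mod_if)
  have hd_g: "hd (unrotate x e) = e ! g x" for x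
    using False by (simp add: unrotate_def hd_rotate_conv_nth g_def)
  have "bij_betw g {x. x < ?p \<and> hd (unrotate x e)} {i. i < ?p \<and> e ! i}"
    by (rule bij_betw_byWitness[where f' = g]) (auto simp: g hd_g)
  then show ?thesis
    by (simp add: bij_betw_same_card ones_def length_filter_conv_card)
qed simp

lemma card_hd_unrotate_flag:
  assumes "hd e" "e \<noteq> []"
  shows "card {x. x < length e \<and> (x = 0 \<longleftrightarrow> t) \<and> hd (unrotate x e)} = (if t then 1 else ones e - 1)"
proof -
  have 0: "unrotate 0 e = e"
    by (simp add: unrotate_def)
  show ?thesis
  proof (cases t)
    case True
    then have "{x. x < length e \<and> (x = 0 \<longleftrightarrow> t) \<and> hd (unrotate x e)} = {0}"
      using assms 0 by auto
    then show ?thesis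
      using True by simp
  next
    case False
    then have "{x. x < length e \<and> (x = 0 \<longleftrightarrow> t) \<and> hd (unrotate x e)} = {x. x < length e \<and> hd (unrotate x e)} - {0}"
      by auto
    moreover have "0 \<in> {x. x < length e \<and> hd (unrotate x e)}"
      using assms 0 by auto
    ultimately show ?thesis
      using False card_hd_unrotate[of e] by (simp add: card_Diff_singleton)
  qed
qed

text \<open>Undoing one phase on occupancy patterns: undo \<open>y\<close> strict rows, split the merged cell
  (\<open>c\<close> is the occupancy of the absorbed one), undo \<open>x\<close> lax rows, and remove the new column
  (\<open>a\<close> tells whether its cell was occupied before).\<close>

definition unmerged :: "bool list \<Rightarrow> nat \<Rightarrow> bool \<Rightarrow> bool list" where
  "unmerged b y c = True # c # tl (unrotate y b)"

definition predecessor :: "bool list \<Rightarrow> nat \<Rightarrow> bool \<Rightarrow> nat \<Rightarrow> bool \<Rightarrow> bool list" where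
  "predecessor b y c x a = a # tl (unrotate x (unmerged b y c))"

text \<open>Adding a column and merging into an occupied cell both leave an occupied cell. The
  occupancies they erase are exactly the two bits \<open>a\<close> and \<open>c\<close>.\<close>

lemma phase_pattern_iff:
  assumes len: "length p = Suc (length b)" and x: "x < length p" and y: "y < length b"
  shows "rotate y (True # tl (tl (rotate x (True # tl p)))) = b \<and> (True # tl p) ! x \<longleftrightarrow>
    (\<exists>c a. hd (unrotate y b) \<and> hd (unrotate x (unmerged b y c)) \<and> p = predecessor b y c x a)"
    (is "?L \<longleftrightarrow> ?R")
proof
  assume L: ?L
  let ?r = "rotate x (True # tl p)"
  have "length ?r = Suc (length b)" "hd ?r"
    using L len x hd_rotate_conv_nth[of "True # tl p" x] by auto
  then obtain c z where r: "?r = True # c # z"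
    using y by (cases ?r; cases "tl ?r") auto
  have "unrotate y b = True # z"
    using L rotate_eq_iff[of y b "True # z"] y by (simp add: r)
  then have *: "hd (unrotate y b)" "unmerged b y c = ?r"
    by (simp_all add: unmerged_def r)
  have "unrotate x ?r = True # tl p"
    using rotate_eq_iff[of x ?r "True # tl p"] x len by simp
  moreover have "p = hd p # tl p"
    using len by (cases p) auto
  ultimately have "hd (unrotate x (unmerged b y c)) \<and> p = predecessor b y c x (hd p)"
    by (simp add: * predecessor_def)
  with * show ?R
    by blast
next
  assume ?R
  then obtain c a where R: "hd (unrotate y b)" "hd (unrotate x (unmerged b y c))" "p = predecessor b y c x a"
    by blast
  have ne: "unrotate y b \<noteq> []" "unrotate x (unmerged b y c) \<noteq> []"
    using y length_unrotate[of y b] length_unrotate[of x "unmerged b y c"]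
    by (auto simp: unmerged_def simp del: length_unrotate)
  have len': "length (unmerged b y c) = Suc (length b)"
    using y by (simp add: unmerged_def)
  have p: "True # tl p = unrotate x (unmerged b y c)"
    using R ne by (cases "unrotate x (unmerged b y c)") (auto simp: predecessor_def)
  have rot: "rotate x (unrotate x (unmerged b y c)) = True # c # tl (unrotate y b)"
    using rotate_unrotate[of x "unmerged b y c"] x len len' by (simp add: unmerged_def)
  have "True # tl (unrotate y b) = unrotate y b"
    using R ne by (cases "unrotate y b") auto
  moreover have "rotate y (unrotate y b) = b"
    using rotate_unrotate[of y b] y by simp
  moreover have "unrotate x (unmerged b y c) ! x"
    using hd_rotate_conv_nth[OF ne(2), of x] rot len len' x by simp
  ultimately show ?L
    unfolding p rot by simp
qed

text \<open>The head overwritten by \<open>a\<close> was occupied in both patterns, so it can be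
  restored and the rotation undone.\<close>

lemma predecessor_inject:
  assumes "predecessor b y c x a = predecessor b y c' x a'" "x \<le> Suc (length b)" "y < length b"
    and "hd (unrotate x (unmerged b y c))" "hd (unrotate x (unmerged b y c'))"
  shows "c = c' \<and> a = a'"
proof -
  have ne: "unrotate x (unmerged b y c'') \<noteq> []" for c''
    using length_unrotate[of x "unmerged b y c''"] by (auto simp: unmerged_def simp del: length_unrotate)
  have "a = a'" "tl (unrotate x (unmerged b y c)) = tl (unrotate x (unmerged b y c'))"
    using assms(1) by (simp_all add: predecessor_def)
  then have "unrotate x (unmerged b y c) = unrotate x (unmerged b y c')"
    using assms(4,5) ne by (intro list.expand) simp_all
  then have "rotate x (unrotate x (unmerged b y c)) = rotate x (unrotate x (unmerged b y c'))"
    by simp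
  then have "unmerged b y c = unmerged b y c'"
    using assms(2,3) by (simp add: rotate_unrotate unmerged_def)
  with \<open>a = a'\<close> show ?thesis
    by (simp add: unmerged_def)
qed

section \<open>Counting codes by the occupancy pattern of their state\<close>

abbreviation occupied :: "nat list \<Rightarrow> bool list" where
  "occupied d \<equiv> map (\<lambda>a. 0 < a) d"

lemma occupied_inc: "0 < length d \<Longrightarrow> occupied (inc d) = True # tl (occupied d)"
  by (cases d) auto

lemma occupied_merge:
  "2 \<le> length d \<Longrightarrow> 0 < hd d \<Longrightarrow> occupied (merge d) = True # tl (tl (occupied d))"
  by (cases d rule: merge.cases) auto

text \<open>Validity of a new pair depends on the state only through its length and nonzero cells,
  and so does the next pattern; this is why counting can forget the actual numbers of
  columns.\<close>

lemma occupied_state_Cons: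
  assumes "valid k ((x, y) # cs)"
  shows "occupied (state k ((x, y) # cs)) =
    rotate y (True # tl (tl (rotate x (True # tl (occupied (state k cs))))))"
proof -
  let ?d = "inc (state k cs)"
  have v: "x < length ?d" "Suc y < length ?d" "0 < ?d ! x"
    using assms by auto
  moreover have "hd (rotate x ?d) = ?d ! x"
    using v(1) hd_rotate_conv_nth[of ?d x] by (cases "?d = []") auto
  ultimately have "occupied (merge (rotate x ?d)) = True # tl (tl (rotate x (occupied ?d)))"
    by (simp add: occupied_merge rotate_map)
  moreover have "occupied ?d = True # tl (occupied (state k cs))"
    using v(1) by (intro occupied_inc) auto
  ultimately show ?thesis
    by (simp flip: rotate_map)
qed

definition codes :: "nat \<Rightarrow> bool list \<Rightarrow> bool list \<Rightarrow> (nat \<times> nat) list set" where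
  "codes k ts b = {cs. valid k cs \<and> map (\<lambda>c. fst c = 0) cs = ts \<and> occupied (state k cs) = b}"

lemma length_codes: "cs \<in> codes k ts b \<Longrightarrow> length cs = length ts"
  by (auto simp: codes_def)

definition phase_choices :: "bool \<Rightarrow> bool list \<Rightarrow> (nat \<times> bool \<times> nat \<times> bool) set" where
  "phase_choices t b = (SIGMA y:{y. y < length b \<and> hd (unrotate y b)}. SIGMA c:UNIV.
     SIGMA x:{x. x < length (unmerged b y c) \<and> (x = 0 \<longleftrightarrow> t) \<and> hd (unrotate x (unmerged b y c))}. UNIV)"

lemma length_unmerged: "y < length b \<Longrightarrow> length (unmerged b y c) = Suc (length b)"
  by (simp add: unmerged_def)

lemma codes_Cons:
  assumes len: "length b = k - Suc (length ts)" and lt: "Suc (length ts) < k"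
  shows "codes k (t # ts) b = (\<Union>(y, c, x, a)\<in>phase_choices t b.
    (\<lambda>cs. (x, y) # cs) ` codes k ts (predecessor b y c x a))"
proof (rule set_eqI)
  fix cs0
  show "cs0 \<in> codes k (t # ts) b \<longleftrightarrow> cs0 \<in> (\<Union>(y, c, x, a)\<in>phase_choices t b.
    (\<lambda>cs. (x, y) # cs) ` codes k ts (predecessor b y c x a))"
  proof (cases cs0)
    case Nil
    then show ?thesis
      by (auto simp: codes_def)
  next
    case (Cons xy cs)
    obtain x y where xy: "xy = (x, y)"
      by (cases xy)
    let ?p = "occupied (state k cs)"
    have *: "cs0 \<in> codes k (t # ts) b \<longleftrightarrow> (valid k cs \<and> map (\<lambda>c. fst c = 0) cs = ts) \<and> (x = 0 \<longleftrightarrow> t) \<and>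
        x < Suc (length b) \<and> y < length b \<and>
        (rotate y (True # tl (tl (rotate x (True # tl ?p)))) = b \<and> (True # tl ?p) ! x)"
    proof (cases "valid k cs \<and> map (\<lambda>c. fst c = 0) cs = ts \<and> x < Suc (length b) \<and> y < length b")
      case True
      then have lcs: "length (state k cs) = Suc (length b)"
        using len lt by (auto simp: length_state)
      have "0 < inc (state k cs) ! x \<longleftrightarrow> (True # tl ?p) ! x"
        using occupied_inc[of "state k cs"] True lcs nth_map[of x "inc (state k cs)" "\<lambda>a. 0 < a"] by auto
      then have val: "valid k ((x, y) # cs) \<longleftrightarrow> (True # tl ?p) ! x"
        using True lcs by simp
      show ?thesis
      proof (cases "(True # tl ?p) ! x")
        case nth: True
        then show ?thesis
          using True val occupied_state_Cons[of k x y cs]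
          by (simp only: codes_def Cons xy mem_Collect_eq list.map fst_conv list.inject) blast
      next
        case False
        then show ?thesis
          using val by (simp only: codes_def Cons xy mem_Collect_eq) blast
      qed
    next
      case False
      show ?thesis
      proof
        assume cs0: "cs0 \<in> codes k (t # ts) b"
        then have "valid k cs" "map (\<lambda>c. fst c = 0) cs = ts" "x < length (state k cs)" "Suc y < length (state k cs)"
          by (auto simp: codes_def Cons xy)
        then show "(valid k cs \<and> map (\<lambda>c. fst c = 0) cs = ts) \<and> (x = 0 \<longleftrightarrow> t) \<and>
          x < Suc (length b) \<and> y < length b \<and>
          (rotate y (True # tl (tl (rotate x (True # tl ?p)))) = b \<and> (True # tl ?p) ! x)"
          using False len lt by (auto simp: length_state)
      qed (use False in blast)
    qed
    have len_p: "length ?p = Suc (length b)" if "valid k cs" "map (\<lambda>c. fst c = 0) cs = ts"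
      using that len lt by (auto simp: length_state)
    have choices: "(y, c, x, a) \<in> phase_choices t b \<longleftrightarrow>
        (y < length b \<and> x < Suc (length b) \<and> (x = 0 \<longleftrightarrow> t)) \<and>
        hd (unrotate y b) \<and> hd (unrotate x (unmerged b y c))" for c a
      using length_unmerged[of y b c] by (auto simp: phase_choices_def)
    have "cs0 \<in> (\<Union>(y, c, x, a)\<in>phase_choices t b.
        (\<lambda>cs. (x, y) # cs) ` codes k ts (predecessor b y c x a)) \<longleftrightarrow>
        (\<exists>c a. (y, c, x, a) \<in> phase_choices t b \<and> cs \<in> codes k ts (predecessor b y c x a))"
      unfolding Cons xy by blast
    also have "\<dots> \<longleftrightarrow> (valid k cs \<and> map (\<lambda>c. fst c = 0) cs = ts) \<and> (x = 0 \<longleftrightarrow> t) \<and>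
        x < Suc (length b) \<and> y < length b \<and>
        (\<exists>c a. hd (unrotate y b) \<and> hd (unrotate x (unmerged b y c)) \<and> ?p = predecessor b y c x a)"
      unfolding choices codes_def mem_Collect_eq
      by (rule iffI; elim exE conjE; intro exI conjI; assumption)
    also have "\<dots> \<longleftrightarrow> cs0 \<in> codes k (t # ts) b"
      unfolding *
    proof (intro conj_cong refl)
      assume "valid k cs \<and> map (\<lambda>c. fst c = 0) cs = ts" "x < Suc (length b)" "y < length b"
      then show "(\<exists>c a. hd (unrotate y b) \<and> hd (unrotate x (unmerged b y c)) \<and> ?p = predecessor b y c x a) \<longleftrightarrow>
          rotate y (True # tl (tl (rotate x (True # tl ?p)))) = b \<and> (True # tl ?p) ! x"
        using phase_pattern_iff[of ?p b x y] len_p by simp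
    qed
    finally show ?thesis ..
  qed
qed

lemma finite_phase_choices: "finite (phase_choices t b)"
  unfolding phase_choices_def by (intro finite_SigmaI) auto

text \<open>The amounts \<open>y\<close> and \<open>x\<close> are counted by occupied cells alone,
  and the predecessor has \<open>ones b + c - 1 + a\<close> of them. Thus a sum over patterns
  collapses to a function of one number.\<close>

lemma sum_phase_choices:
  "(\<Sum>(y, c, x, a)\<in>phase_choices t b. v (ones (predecessor b y c x a))) = transfer t v (ones b)"
proof -
  let ?Y = "{y. y < length b \<and> hd (unrotate y b)}"
  let ?X = "\<lambda>y c. {x. x < length (unmerged b y c) \<and> (x = 0 \<longleftrightarrow> t) \<and> hd (unrotate x (unmerged b y c))}"
  have ones_e: "ones (unmerged b y c) = ones b + of_bool c" if "y \<in> ?Y" for y c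
  proof -
    have "unrotate y b \<noteq> []"
      using that length_unrotate[of y b] by (auto simp del: length_unrotate)
    then have "ones (unrotate y b) = Suc (ones (tl (unrotate y b)))"
      using that by (cases "unrotate y b") auto
    then show ?thesis
      by (simp add: unmerged_def)
  qed
  have ones_p: "ones (predecessor b y c x a) = ones b + of_bool c - 1 + of_bool a"
    if "y \<in> ?Y" "x \<in> ?X y c" for y c x a
  proof -
    have "unrotate x (unmerged b y c) \<noteq> []"
      using that length_unrotate[of x "unmerged b y c"] by (auto simp del: length_unrotate)
    then have "ones (unrotate x (unmerged b y c)) = Suc (ones (tl (unrotate x (unmerged b y c))))"
      using that by (cases "unrotate x (unmerged b y c)") auto
    then show ?thesis
      using ones_e[OF that(1)] by (simp add: predecessor_def)
  qed
  have pos: "0 < ones b" if "?Y \<noteq> {}"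
    unfolding card_hd_unrotate[symmetric] using that by (simp only: card_gt_0_iff) simp
  let ?s = "\<lambda>c. (if t then 1 else ones b + of_bool c - 1) * (v (ones b + of_bool c) + v (ones b + of_bool c - 1))"
  have card_X: "card (?X y c) = (if t then 1 else ones b + of_bool c - 1)" if "y \<in> ?Y" for y c
  proof -
    have "hd (unmerged b y c)" "unmerged b y c \<noteq> []"
      by (simp_all add: unmerged_def)
    then show ?thesis
      using card_hd_unrotate_flag[of "unmerged b y c" t] ones_e[OF that] by simp
  qed
  have "(\<Sum>(y, c, x, a)\<in>phase_choices t b. v (ones (predecessor b y c x a))) =
      (\<Sum>y\<in>?Y. \<Sum>c\<in>UNIV. \<Sum>x\<in>?X y c. \<Sum>a\<in>UNIV. v (ones (predecessor b y c x a)))"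
    unfolding phase_choices_def by (subst sum.Sigma[symmetric], simp, simp)+ simp
  also have "\<dots> = (\<Sum>y\<in>?Y. \<Sum>c\<in>UNIV. \<Sum>x\<in>?X y c. v (ones b + of_bool c) + v (ones b + of_bool c - 1))"
  proof (intro sum.cong refl)
    fix y c x
    assume yx: "y \<in> ?Y" "x \<in> ?X y c"
    then have "0 < ones b"
      using pos by blast
    then show "(\<Sum>a\<in>UNIV. v (ones (predecessor b y c x a))) = v (ones b + of_bool c) + v (ones b + of_bool c - 1)"
      unfolding ones_p[OF yx] by (cases c) (simp_all add: UNIV_bool)
  qed
  also have "\<dots> = (\<Sum>y\<in>?Y. \<Sum>c\<in>UNIV. ?s c)"
    by (intro sum.cong refl) (simp only: sum_constant card_X of_nat_id)
  also have "\<dots> = ones b * (\<Sum>c\<in>UNIV. ?s c)"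
    by (simp add: card_hd_unrotate)
  also have "\<dots> = transfer t v (ones b)"
    by (simp add: transfer_def UNIV_bool)
  finally show ?thesis .
qed

lemma card_codes:
  "length ts < k \<Longrightarrow> length b = k - length ts \<Longrightarrow>
     finite (codes k ts b) \<and> card (codes k ts b) = code_count ts (ones b)"
proof (induction ts arbitrary: b)
  case Nil
  have "codes k [] b = (if b = replicate k False then {[]} else {})"
    by (auto simp: codes_def)
  moreover have "b = replicate k False \<longleftrightarrow> ones b = 0"
    using ones_eq_0_iff[of b] Nil by simp
  ultimately show ?case
    by simp
next
  case (Cons t ts)
  let ?I = "phase_choices t b"
  let ?C = "\<lambda>(y, c, x, a). (\<lambda>cs. (x, y) # cs) ` codes k ts (predecessor b y c x a)"
  have eq: "codes k (t # ts) b = (\<Union>i\<in>?I. ?C i)"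
    using codes_Cons[of b k ts t] Cons.prems by simp
  have IH: "finite (codes k ts (predecessor b y c x a)) \<and>
      card (codes k ts (predecessor b y c x a)) = code_count ts (ones (predecessor b y c x a))"
    if "(y, c, x, a) \<in> ?I" for y c x a
    using that Cons.prems length_unmerged[of y b c]
    by (intro Cons.IH) (auto simp: phase_choices_def predecessor_def)
  have fin: "\<forall>i\<in>?I. finite (?C i)"
    using IH by auto
  have disj: "?C i \<inter> ?C i' = {}" if I: "i \<in> ?I" "i' \<in> ?I" and ne: "i \<noteq> i'" for i i'
  proof (rule ccontr)
    assume "?C i \<inter> ?C i' \<noteq> {}"
    then obtain cs where cs: "cs \<in> ?C i" "cs \<in> ?C i'"
      by blast
    obtain y c x a y' c' x' a' where i: "i = (y, c, x, a)" "i' = (y', c', x', a')"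
      by (cases i, cases i')
    have "x = x'" "y = y'" "predecessor b y c x a = predecessor b y c' x a'"
      using cs by (auto simp: i codes_def)
    moreover have "x \<le> Suc (length b)" "y < length b" "hd (unrotate x (unmerged b y c))"
        "hd (unrotate x (unmerged b y c'))"
      using I \<open>x = x'\<close> \<open>y = y'\<close> length_unmerged[of y b c] by (auto simp: phase_choices_def i)
    ultimately have "c = c' \<and> a = a'"
      by (intro predecessor_inject)
    with \<open>x = x'\<close> \<open>y = y'\<close> ne show False
      by (simp add: i)
  qed
  have "card (codes k (t # ts) b) = (\<Sum>i\<in>?I. card (?C i))"
    unfolding eq using fin disj by (intro card_UN_disjoint finite_phase_choices) auto
  also have "\<dots> = (\<Sum>(y, c, x, a)\<in>?I. code_count ts (ones (predecessor b y c x a)))"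
    using IH by (intro sum.cong refl) (auto simp: card_image inj_on_def)
  also have "\<dots> = transfer t (code_count ts) (ones b)"
    by (rule sum_phase_choices)
  finally show ?case
    using eq fin finite_phase_choices by auto
qed

section \<open>Fibres over a prescribed vector\<close>

text \<open>For \<open>u = 1\<close> only the first cell of the word is occupied, so
  \<open>x = 0\<close> is forced. This is the extra \<open>True\<close> at the end of the flags, the
  counterpart of the forced last fixed point of a pistol.\<close>

lemma fst_last_valid: "valid k cs \<Longrightarrow> cs \<noteq> [] \<Longrightarrow> fst (last cs) = 0"
proof (induction cs)
  case (Cons c cs)
  show ?case
  proof (cases "cs = []")
    case True
    obtain x y where c: "c = (x, y)"
      by (cases c)
    have "0 < inc (replicate k 0) ! x" "x < k"
      using Cons.prems by (simp_all add: c True)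
    then show ?thesis
      by (cases k; cases x) (auto simp: c True)
  next
    case False
    then show ?thesis
      using Cons by (cases c) auto
  qed
qed simp

lemma irreducible_fibre:
  assumes "2 \<le> k"
  shows "{l \<in> irreducible_k_shapes k. \<forall>i\<in>{1..k - 2}. free_site k l i \<longleftrightarrow> t i} =
    shape k ` codes k (map t [1..<k - 1] @ [True]) [True]"
proof -
  have free: "(\<forall>i\<in>{1..k - 2}. free_site k (shape k cs) i \<longleftrightarrow> t i) \<longleftrightarrow>
      cs \<in> codes k (map t [1..<k - 1] @ [True]) [True]"
    if cs: "valid k cs" "length cs = k - 1" for cs
  proof -
    \<comment> \<open>After \<open>k - 1\<close> phases the word has shrunk to one cell containing
      all \<open>k - 1\<close> columns, so every complete code ends in the pattern
      \<open>[True]\<close>.\<close>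
    have len: "length (state k cs) = 1"
      using cs assms by (simp add: length_state)
    have "sum_list (state k cs) = k - 1"
      using cs by (simp add: sum_list_state)
    with len have occ: "occupied (state k cs) = [True]"
      using assms by (cases "state k cs") auto
    have "free_site k (shape k cs) i \<longleftrightarrow> fst (cs ! (i - 1)) = 0" if "i \<in> {1..k - 2}" for i
      using free_site_shape[OF cs, of i] that by auto
    moreover have "map (\<lambda>c. fst c = 0) cs = map t [1..<k - 1] @ [True] \<longleftrightarrow>
        (\<forall>i\<in>{1..k - 2}. fst (cs ! (i - 1)) = 0 \<longleftrightarrow> t i)"
    proof -
      have ne: "cs \<noteq> []"
        using cs assms by auto
      have "map (\<lambda>c. fst c = 0) cs = map (\<lambda>c. fst c = 0) (butlast cs) @ [True]"
        using fst_last_valid[OF cs(1) ne]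
        by (subst append_butlast_last_id[OF ne, symmetric], subst map_append) simp
      then have "map (\<lambda>c. fst c = 0) cs = map t [1..<k - 1] @ [True] \<longleftrightarrow>
          map (\<lambda>c. fst c = 0) (butlast cs) = map t [1..<k - 1]"
        by simp
      also have "\<dots> \<longleftrightarrow> (\<forall>n<k - 2. fst (cs ! n) = 0 \<longleftrightarrow> t (Suc n))"
        using cs by (auto simp: list_eq_iff_nth_eq nth_butlast)
      also have "\<dots> \<longleftrightarrow> (\<forall>i\<in>{1..k - 2}. fst (cs ! (i - 1)) = 0 \<longleftrightarrow> t i)"
      proof
        assume *: "\<forall>n<k - 2. fst (cs ! n) = 0 \<longleftrightarrow> t (Suc n)"
        show "\<forall>i\<in>{1..k - 2}. fst (cs ! (i - 1)) = 0 \<longleftrightarrow> t i"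
        proof
          fix i
          assume "i \<in> {1..k - 2}"
          then show "fst (cs ! (i - 1)) = 0 \<longleftrightarrow> t i"
            using *[rule_format, of "i - 1"] by auto
        qed
      next
        assume *: "\<forall>i\<in>{1..k - 2}. fst (cs ! (i - 1)) = 0 \<longleftrightarrow> t i"
        show "\<forall>n<k - 2. fst (cs ! n) = 0 \<longleftrightarrow> t (Suc n)"
          using *[rule_format, of "Suc _"] by auto
      qed
      finally show ?thesis .
    qed
    ultimately show ?thesis
      using cs occ by (simp add: codes_def)
  qed
  have len: "valid k cs \<and> length cs = k - 1" if "cs \<in> codes k (map t [1..<k - 1] @ [True]) [True]" for cs
    using that length_codes[OF that] assms by (simp add: codes_def)
  have img: "irreducible_k_shapes k = shape k ` {cs. valid k cs \<and> length cs = k - 1}"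
    using bij_betw_shape[of k] assms by (simp add: bij_betw_def)
  show ?thesis
    unfolding img using free len by auto
qed

lemma card_irreducible_fibre:
  assumes "2 \<le> k"
  shows "finite {l \<in> irreducible_k_shapes k. \<forall>i\<in>{1..k - 2}. free_site k l i \<longleftrightarrow> t i}"
    and "card {l \<in> irreducible_k_shapes k. \<forall>i\<in>{1..k - 2}. free_site k l i \<longleftrightarrow> t i} =
      card {f \<in> surj_pistols (k - 1). \<forall>i\<in>{1..k - 2}. f (2*i) = 2*i \<longleftrightarrow> t i}"
proof -
  let ?C = "codes k (map t [1..<k - 1] @ [True]) [True]"
  have C: "finite ?C" "card ?C = code_count (map t [1..<k - 1] @ [True]) 1"
    using card_codes[of "map t [1..<k - 1] @ [True]" k "[True]"] assms by simp_all
  show "finite {l \<in> irreducible_k_shapes k. \<forall>i\<in>{1..k - 2}. free_site k l i \<longleftrightarrow> t i}"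
    unfolding irreducible_fibre[OF assms] using C by simp
  have "?C \<subseteq> {cs. valid k cs \<and> length cs = k - 1}"
  proof
    fix cs
    assume "cs \<in> ?C"
    then show "cs \<in> {cs. valid k cs \<and> length cs = k - 1}"
      using length_codes[of cs k _ "[True]"] assms by (fastforce simp: codes_def)
  qed
  then have "card (shape k ` ?C) = card ?C"
    by (intro card_image inj_on_subset[OF inj_on_shape])
  also have "int \<dots> = foldl pistol_step (\<lambda>_. 1) (map t [1..<k - 1]) 1"
    unfolding C by (rule code_count_eq_foldl)
  also have "\<dots> = int (card {f \<in> surj_pistols (k - 1). \<forall>i\<in>{1..k - 2}. f (2*i) = 2*i \<longleftrightarrow> t i})"
    using card_surj_pistols[of "k - 2" t] assms by (simp add: Suc_diff_le numeral_2_eq_2 Suc_diff_Suc)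
  finally show "card {l \<in> irreducible_k_shapes k. \<forall>i\<in>{1..k - 2}. free_site k l i \<longleftrightarrow> t i} =
      card {f \<in> surj_pistols (k - 1). \<forall>i\<in>{1..k - 2}. f (2*i) = 2*i \<longleftrightarrow> t i}"
    unfolding irreducible_fibre[OF assms] by linarith
qed

lemma ex_bij_betw_fibres:
  assumes "\<And>T. finite {a \<in> A. g a = T}" "\<And>T. finite {b \<in> B. h b = T}"
    and "\<And>T. card {a \<in> A. g a = T} = card {b \<in> B. h b = T}"
  shows "\<exists>\<phi>. bij_betw \<phi> A B \<and> (\<forall>a\<in>A. h (\<phi> a) = g a)"
proof -
  have "\<exists>F. bij_betw F {a \<in> A. g a = T} {b \<in> B. h b = T}" for T
    using assms by (intro finite_same_card_bij) auto
  then obtain F where F: "\<And>T. bij_betw (F T) {a \<in> A. g a = T} {b \<in> B. h b = T}"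
    by metis
  have F': "F (g a) a \<in> B \<and> h (F (g a) a) = g a" if "a \<in> A" for a
    using bij_betw_apply[OF F[of "g a"], of a] that by simp
  have "bij_betw (\<lambda>a. F (g a) a) A B"
    unfolding bij_betw_def
  proof
    show "inj_on (\<lambda>a. F (g a) a) A"
    proof (rule inj_onI)
      fix a a'
      assume a: "a \<in> A" "a' \<in> A" "F (g a) a = F (g a') a'"
      then have "g a = g a'"
        using F'[of a] F'[of a'] by simp
      then show "a = a'"
        using a inj_onD[OF bij_betw_imp_inj_on[OF F[of "g a"]], of a a'] by simp
    qed
    show "(\<lambda>a. F (g a) a) ` A = B"
    proof
      show "B \<subseteq> (\<lambda>a. F (g a) a) ` A"
      proof
        fix b
        assume "b \<in> B"
        then obtain a where "a \<in> A" "g a = h b" "b = F (h b) a"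
          using bij_betw_imp_surj_on[OF F[of "h b"]] by blast
        then show "b \<in> (\<lambda>a. F (g a) a) ` A"
          by (intro image_eqI[of _ _ a]) simp_all
      qed
    qed (use F' in auto)
  qed
  with F' show ?thesis
    by blast
qed

theorem theorem2:
  fixes k :: nat
  assumes "k \<ge> 3"
  shows "\<exists>\<phi>. bij_betw \<phi> (surj_pistols (k - 1)) (irreducible_k_shapes k) \<and>
             (\<forall>f\<in>surj_pistols (k - 1). fr_vec k (\<phi> f) = fix_vec k f)"
proof -
  \<comment> \<open>Vectors are encoded as sets of indices; a set that leaves
    \<open>{1..k - 2}\<close> has empty fibres on both sides.\<close>
  define g where "g f = {i \<in> {1..k - 2}. f (2*i) = 2*i}" for f :: "nat \<Rightarrow> nat"
  define h where "h l = {i \<in> {1..k - 2}. free_site k l i}" for l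
  have k: "2 \<le> k"
    using assms by simp
  have fin: "finite (surj_pistols (k - 1))"
    by (rule finite_subset[of _ "{1..2 * (k - 1)} \<rightarrow>\<^sub>E (\<lambda>i. 2*i) ` {1..k - 1}"])
      (auto simp: surj_pistols_def intro!: finite_PiE)
  have fibre_g: "{f \<in> A. g f = T} = (if T \<subseteq> {1..k - 2} then {f \<in> A. \<forall>i\<in>{1..k - 2}. f (2*i) = 2*i \<longleftrightarrow> i \<in> T} else {})"
    for T A
    unfolding g_def by auto
  have fibre_h: "{l \<in> A. h l = T} = (if T \<subseteq> {1..k - 2} then {l \<in> A. \<forall>i\<in>{1..k - 2}. free_site k l i \<longleftrightarrow> i \<in> T} else {})"
    for T A
    unfolding h_def by auto
  have "\<exists>\<phi>. bij_betw \<phi> (surj_pistols (k - 1)) (irreducible_k_shapes k) \<and>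
      (\<forall>f\<in>surj_pistols (k - 1). h (\<phi> f) = g f)"
  proof (rule ex_bij_betw_fibres)
    show "finite {f \<in> surj_pistols (k - 1). g f = T}" for T
      using fin by simp
    show "finite {l \<in> irreducible_k_shapes k. h l = T}" for T
      unfolding fibre_h using card_irreducible_fibre(1)[OF k, of "\<lambda>i. i \<in> T"] by simp
    show "card {f \<in> surj_pistols (k - 1). g f = T} = card {l \<in> irreducible_k_shapes k. h l = T}" for T
      unfolding fibre_g fibre_h using card_irreducible_fibre(2)[OF k, of "\<lambda>i. i \<in> T"] by simp
  qed
  moreover have "fr_vec k l = fix_vec k f" if "h l = g f" for l f
  proof -
    have "free_site k l i \<longleftrightarrow> f (2*i) = 2*i" if "i \<in> set [1..<k - 1]" for i
    proof -
      have "i \<in> {1..k - 2}"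
        using that by auto
      then show ?thesis
        using \<open>h l = g f\<close> unfolding g_def h_def by blast
    qed
    then show ?thesis
      by (simp add: fr_vec_def fix_vec_def)
  qed
  ultimately show ?thesis
    by blast
qed

end
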